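(* Let $\mathbf{m}_0\in\mathbb{R}^n$, let $\mathbf{K}_0\in\mathbb{R}^{n\times n}$ and $\mathbf{R}\in\mathbb{R}^{p\times p}$ be symmetric positive definite, and let $\mathbf{H}\in\mathbb{R}^{p\times n}$. Assume the Gaussian prior $\mathbf{f}\sim\mathcal{N}(\mathbf{m}_0,\mathbf{K}_0)$ and the linear observation model $\mathbf{y}=\mathbf{H}\mathbf{f}+\boldsymbol{\varepsilon}$, $\boldsymbol{\varepsilon}\sim\mathcal{N}(\mathbf{0},\mathbf{R})$, with $\boldsymbol{\varepsilon}$ independent of $\mathbf{f}$. Fix a realized value $\mathbf{y}\in\mathbb{R}^p$ and an integer $k\ge 1$. If the same realized $\mathbf{y}$ is treated as $k$ independent observations with identical $(\mathbf{H},\mathbf{R})$, then the resulting posterior covariance $\mathbf{K}_k$ and posterior mean $\mathbf{m}_k$ of $\mathbf{f}$ equal $$\mathbf{K}_k=\left(\mathbf{K}_0^{-1}+k\,\mathbf{H}^\top\mathbf{R}^{-1}\mathbf{H}\right)^{-1},\qquad \mathbf{m}_k=\mathbf{K}_k\left(\mathbf{K}_0^{-1}\mathbf{m}_0+k\,\mathbf{H}^\top\mathbf{R}^{-1}\mathbf{y}\right).$$ In particular, for $p=n$ and $\mathbf{H}=\mathbf{I}$ one has $\mathbf{K}_k=(\mathbf{K}_0^{-1}+k\,\mathbf{R}^{-1})^{-1}\to\mathbf{0}$ and $\mathbf{m}_k\to\mathbf{y}$ as $k\to\infty$.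
   Context: Treating the same realized $\mathbf{y}$ as $k$ independent observations with identical $(\mathbf{H},\mathbf{R})$ means: use the model $\mathbf{y}_i=\mathbf{H}\mathbf{f}+\boldsymbol{\varepsilon}_i$, $i=1,\dots,k$, with $\boldsymbol{\varepsilon}_1,\dots,\boldsymbol{\varepsilon}_k$ i.i.d. $\mathcal{N}(\mathbf{0},\mathbf{R})$ and independent of $\mathbf{f}$, and take the (Gaussian) conditional distribution of $\mathbf{f}$ given $\mathbf{y}_1=\dots=\mathbf{y}_k=\mathbf{y}$. Equivalently, the posterior density of $\mathbf{f}$ is proportional to the prior density times the $k$-th power of the likelihood $\exp\!\big(-\tfrac12(\mathbf{y}-\mathbf{H}\mathbf{f})^\top\mathbf{R}^{-1}(\mathbf{y}-\mathbf{H}\mathbf{f})\big)$. *)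

theory Defs
  imports "HOL-Probability.Probability"
begin

definition sym_pos_def :: "real^'n^'n \<Rightarrow> bool" where
  "sym_pos_def A \<longleftrightarrow> transpose A = A \<and> (\<forall>x. x \<noteq> 0 \<longrightarrow> 0 < x \<bullet> (A *v x))"

(* Density of N(m, K); meaningful for symmetric positive definite K. *)
definition mvn_density :: "real^'n \<Rightarrow> real^'n^'n \<Rightarrow> real^'n \<Rightarrow> real" where
  "mvn_density m K x =
     exp (- (1/2) * ((x - m) \<bullet> (matrix_inv K *v (x - m)))) / sqrt ((2 * pi) ^ CARD('n) * det K)"

definition mvn_distributed ::
    "'w measure \<Rightarrow> ('w \<Rightarrow> real^'n) \<Rightarrow> real^'n \<Rightarrow> real^'n^'n \<Rightarrow> bool" where
  "mvn_distributed M X m K \<longleftrightarrow> distributed M lborel X (\<lambda>x. ennreal (mvn_density m K x))"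

definition mean_vector :: "(real^'n) measure \<Rightarrow> real^'n" where
  "mean_vector \<mu> = (\<integral>x. x \<partial>\<mu>)"

definition covariance_matrix :: "(real^'n) measure \<Rightarrow> real^'n^'n" where
  "covariance_matrix \<mu> =
     (\<chi> i j. \<integral>x. (x $ i - mean_vector \<mu> $ i) * (x $ j - mean_vector \<mu> $ j) \<partial>\<mu>)"

definition regular_conditional_distribution ::
    "'w measure \<Rightarrow> ('w \<Rightarrow> 'a) \<Rightarrow> 'a measure \<Rightarrow> ('w \<Rightarrow> 'b) \<Rightarrow> 'b measure \<Rightarrow> ('b \<Rightarrow> 'a measure) \<Rightarrow> bool" where
  "regular_conditional_distribution M X L Y N \<kappa> \<longleftrightarrow>
     \<kappa> \<in> N \<rightarrow>\<^sub>M prob_algebra L \<and>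
     (\<forall>A\<in>sets L. \<forall>B\<in>sets N.
        emeasure M {\<omega> \<in> space M. X \<omega> \<in> A \<and> Y \<omega> \<in> B} =
        (\<integral>\<^sup>+z. emeasure (\<kappa> z) A * indicator B z \<partial>distr M N Y))"

definition weakly_continuous_on ::
    "'b::topological_space set \<Rightarrow> ('b \<Rightarrow> 'a::topological_space measure) \<Rightarrow> bool" where
  "weakly_continuous_on S \<kappa> \<longleftrightarrow>
     (\<forall>g::'a \<Rightarrow> real. continuous_on UNIV g \<and> bounded (range g) \<longrightarrow>
        continuous_on S (\<lambda>z. \<integral>x. g x \<partial>\<kappa> z))"

(* A regular conditional distribution is determined only up to null sets of the law of Y.
   Its value at a single point z of probability 0 is fixed by taking the version that depends
   weakly continuously on the conditioning value; when the law of Y charges every nonempty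
   open subset of the space of N, there is at most one such version. *)
definition conditional_distribution_at ::
    "'w measure \<Rightarrow> ('w \<Rightarrow> 'a::topological_space) \<Rightarrow> ('w \<Rightarrow> 'b::topological_space) \<Rightarrow> 'b measure
      \<Rightarrow> 'b \<Rightarrow> 'a measure \<Rightarrow> bool" where
  "conditional_distribution_at M X Y N z \<mu> \<longleftrightarrow>
     (\<exists>\<kappa>. regular_conditional_distribution M X borel Y N \<kappa> \<and>
          weakly_continuous_on (space N) \<kappa> \<and> \<kappa> z = \<mu>)"

(* The library's indep_var requires both random variables to have the same codomain type;
   this is the same notion for two different codomain types. *)
definition indep_rvs ::
    "'w measure \<Rightarrow> 'a measure \<Rightarrow> ('w \<Rightarrow> 'a) \<Rightarrow> 'b measure \<Rightarrow> ('w \<Rightarrow> 'b) \<Rightarrow> bool" where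
  "indep_rvs M L X N Y \<longleftrightarrow>
     X \<in> M \<rightarrow>\<^sub>M L \<and> Y \<in> M \<rightarrow>\<^sub>M N \<and>
     prob_space.indep_set M {X -` A \<inter> space M | A. A \<in> sets L} {Y -` B \<inter> space M | B. B \<in> sets N}"

(* Mutual independence of f, eps 1, ..., eps k is expressed as mutual independence of the
   noises together with independence of f from the whole noise family. *)
definition linear_gaussian_model ::
    "nat \<Rightarrow> real^'n \<Rightarrow> real^'n^'n \<Rightarrow> real^'p^'p
      \<Rightarrow> 'w measure \<Rightarrow> ('w \<Rightarrow> real^'n) \<Rightarrow> (nat \<Rightarrow> 'w \<Rightarrow> real^'p) \<Rightarrow> bool" where
  "linear_gaussian_model k m0 K0 R M f \<epsilon> \<longleftrightarrow>
     prob_space M \<and>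
     mvn_distributed M f m0 K0 \<and>
     (\<forall>i\<in>{1..k}. mvn_distributed M (\<epsilon> i) 0 R) \<and>
     prob_space.indep_vars M (\<lambda>_. borel) \<epsilon> {1..k} \<and>
     indep_rvs M borel f (\<Pi>\<^sub>M i\<in>{1..k}. borel) (\<lambda>\<omega>. \<lambda>i\<in>{1..k}. \<epsilon> i \<omega>)"

definition observations ::
    "nat \<Rightarrow> real^'n^'p \<Rightarrow> ('w \<Rightarrow> real^'n) \<Rightarrow> (nat \<Rightarrow> 'w \<Rightarrow> real^'p) \<Rightarrow> 'w \<Rightarrow> nat \<Rightarrow> real^'p" where
  "observations k H f \<epsilon> \<omega> = (\<lambda>i\<in>{1..k}. H *v f \<omega> + \<epsilon> i \<omega>)"

(* The law of f given that all k observations take the same value y. *)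
definition repeated_posterior ::
    "nat \<Rightarrow> real^'n^'p \<Rightarrow> real^'p
      \<Rightarrow> 'w measure \<Rightarrow> ('w \<Rightarrow> real^'n) \<Rightarrow> (nat \<Rightarrow> 'w \<Rightarrow> real^'p) \<Rightarrow> (real^'n) measure \<Rightarrow> bool" where
  "repeated_posterior k H y M f \<epsilon> \<mu> \<longleftrightarrow>
     conditional_distribution_at M f (observations k H f \<epsilon>)
       (\<Pi>\<^sub>M i\<in>{1..k}. borel) (\<lambda>i\<in>{1..k}. y) \<mu>"

end

theory Submission
  imports Defs
begin

text \<open>The joint density of \<open>f\<close> and the \<open>k\<close> observations is the exponential of a quadratic form. Completing the
  square in \<open>x\<close> factors it as a function of the observations times a Gaussian kernel in \<open>x\<close> with precision
  \<open>P = K\<^sub>0\<^sup>-\<^sup>1 + k H\<^sup>T R\<^sup>-\<^sup>1 H\<close> and centre \<open>P\<^sup>-\<^sup>1 (K\<^sub>0\<^sup>-\<^sup>1 m\<^sub>0 + H\<^sup>T R\<^sup>-\<^sup>1 \<Sum>\<^sub>i z\<^sub>i)\<close>, which yields a regular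
  conditional distribution of \<open>f\<close> that depends weakly continuously on the observations. The law of the
  observations has a positive density, so it charges every nonempty open set, and therefore two weakly
  continuous versions agree everywhere. All Gaussians are normalised by the integral of
  their kernel, so no determinant is ever computed; the covariance comes from translation invariance of
  Lebesgue measure. For \<open>H = I\<close> the precision grows linearly in \<open>k\<close>, which gives the limits.\<close>

section \<open>Symmetric positive definite matrices\<close>

text \<open>The event that all observations equal \<open>y\<close> has probability zero, so a
  conditional law that is determined only almost everywhere says nothing at that point. This is why
  the kernel is built for every observation vector \<open>z\<close>, although only the constant one
  is finally evaluated. Uniqueness needs no countable family of test functions: for one bounded
  continuous function the set where two versions disagree is relatively open, and almost everywhere
  agreement makes it null, so it misses every point of the support. The model states its normal laws
  with a square root of \<open>det K\<close>; only the positivity of that number is needed, and it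
  is read off from the total mass 1. Every integrability question is settled by domination by
  \<open>exp (b * norm x)\<close> times the kernel. The limits come with a rate: if \<open>c\<close>
  is a coercivity constant of \<open>matrix_inv R\<close>, the posterior covariance maps
  \<open>v\<close> to a vector of norm at most \<open>norm v / (k * c)\<close>.\<close>

lemma inner_matrix_vector_transpose:
  fixes A :: "real^'n^'m"
  shows "x \<bullet> (A *v y) = (transpose A *v x) \<bullet> y"
  by (simp add: dot_lmul_matrix)

lemma sym_pos_def_self_adjoint:
  "sym_pos_def A \<Longrightarrow> x \<bullet> (A *v y) = (A *v x) \<bullet> y"
  by (metis inner_matrix_vector_transpose sym_pos_def_def)

lemma sym_pos_def_nonneg: "sym_pos_def A \<Longrightarrow> 0 \<le> x \<bullet> (A *v x)"
  by (cases "x = 0") (auto simp: sym_pos_def_def intro: less_imp_le)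

lemma sym_pos_def_invertible: "sym_pos_def A \<Longrightarrow> invertible A"
  unfolding invertible_left_inverse matrix_left_invertible_ker
  by (metis inner_zero_right less_irrefl sym_pos_def_def)

lemma matrix_inv_cancel:
  assumes "invertible A"
  shows "A ** matrix_inv A = mat 1" "matrix_inv A ** A = mat 1"
  using someI_ex[OF assms[unfolded invertible_def]] unfolding matrix_inv_def by auto

lemma sym_pos_def_matrix_inv_cancel:
  assumes "sym_pos_def A"
  shows "A *v (matrix_inv A *v x) = x" "matrix_inv A *v (A *v x) = x"
  using matrix_inv_cancel[OF sym_pos_def_invertible[OF assms]]
  by (simp_all add: matrix_vector_mul_assoc)

lemma sym_pos_def_matrix_inv:
  fixes A :: "real^'n^'n"
  assumes A: "sym_pos_def A"
  shows "sym_pos_def (matrix_inv A)"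
  unfolding sym_pos_def_def
proof (intro conjI allI impI)
  have "(transpose (matrix_inv A) *v x) \<bullet> y = (matrix_inv A *v x) \<bullet> y" for x y
    using sym_pos_def_self_adjoint[OF A, of "matrix_inv A *v x" "matrix_inv A *v y"]
    by (simp add: sym_pos_def_matrix_inv_cancel[OF A] flip: inner_matrix_vector_transpose del: transpose_matrix_vector)
  then show "transpose (matrix_inv A) = matrix_inv A"
    unfolding matrix_eq using vector_eq_rdot by blast
next
  fix x :: "real^'n" assume "x \<noteq> 0"
  then have "matrix_inv A *v x \<noteq> 0"
    using sym_pos_def_matrix_inv_cancel(1)[OF A, of x] by auto
  then have "0 < (matrix_inv A *v x) \<bullet> (A *v (matrix_inv A *v x))"
    using A by (simp add: sym_pos_def_def)
  then show "0 < x \<bullet> (matrix_inv A *v x)"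
    by (simp add: sym_pos_def_matrix_inv_cancel[OF A] inner_commute)
qed

text \<open>By compactness \<open>c\<close> can be the minimum of the form on the unit sphere;
  homogeneity extends the bound to all vectors. This yields both Gaussian integrability and the
  decay of the posterior covariance.\<close>

lemma sym_pos_def_coercive:
  fixes A :: "real^'n^'n"
  assumes A: "sym_pos_def A"
  obtains c where "c > 0" "\<And>x. c * (norm x)\<^sup>2 \<le> x \<bullet> (A *v x)"
proof -
  have "continuous_on (sphere 0 1) (\<lambda>x. x \<bullet> (A *v x))"
    by (intro continuous_intros)
  moreover have "sphere (0::real^'n) 1 \<noteq> {}" 
    by (metis norm_axis_1 dist_0_norm empty_iff mem_sphere)
  ultimately obtain u where u: "u \<in> sphere 0 1" "\<And>x. x \<in> sphere 0 1 \<Longrightarrow> u \<bullet> (A *v u) \<le> x \<bullet> (A *v x)"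
    using continuous_attains_inf[OF compact_sphere] by blast
  show thesis
  proof
    show "u \<bullet> (A *v u) > 0"
      using A u(1) by (metis dist_0_norm mem_sphere norm_zero sym_pos_def_def zero_neq_one)
    fix x :: "real^'n"
    show "u \<bullet> (A *v u) * (norm x)\<^sup>2 \<le> x \<bullet> (A *v x)"
    proof (cases "x = 0")
      case False
      let ?e = "x /\<^sub>R norm x"
      have "u \<bullet> (A *v u) * (norm x)\<^sup>2 \<le> (?e \<bullet> (A *v ?e)) * (norm x)\<^sup>2"
        using False by (intro mult_right_mono u) auto
      also have "\<dots> = x \<bullet> (A *v x)"
        using False by (simp add: matrix_vector_mult_scaleR power2_eq_square field_simps)
      finally show ?thesis .
    qed simp
  qed
qed

text \<open>With \<open>x = matrix_inv A *v v\<close>, coercivity and Cauchy-Schwarz give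
  \<open>c * norm x ^ 2 \<le> x \<bullet> v \<le> norm x * norm v\<close>.\<close>

lemma norm_matrix_inv_le:
  assumes A: "sym_pos_def A" and c: "c > 0" and coercive: "\<And>x. c * (norm x)\<^sup>2 \<le> x \<bullet> (A *v x)"
  shows "norm (matrix_inv A *v v) \<le> norm v / c"
proof -
  let ?x = "matrix_inv A *v v"
  have "c * (norm ?x)\<^sup>2 \<le> norm ?x * norm v"
    using coercive[of ?x] norm_cauchy_schwarz[of ?x v] by (simp add: sym_pos_def_matrix_inv_cancel[OF A])
  then have "c * norm ?x \<le> norm v"
    by (cases "norm ?x = 0") (auto simp: power2_eq_square)
  with c show ?thesis by (simp add: field_simps)
qed

lemma transpose_add: "transpose (A + B) = transpose A + transpose B"
  by (simp add: transpose_def vec_eq_iff)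

text \<open>\<open>H\<close> may have a kernel, so the added term is only semidefinite; strictness
  is inherited from \<open>P\<close>.\<close>

lemma sym_pos_def_posterior_precision:
  fixes H :: "real^'n^'p"
  assumes P: "sym_pos_def P" and S: "sym_pos_def S" and k: "0 \<le> k"
  shows "sym_pos_def (P + k *\<^sub>R (transpose H ** S ** H))"
  unfolding sym_pos_def_def
proof (intro conjI allI impI)
  have "transpose P = P" "transpose S = S" using P S by (auto simp: sym_pos_def_def)
  then show "transpose (P + k *\<^sub>R (transpose H ** S ** H)) = P + k *\<^sub>R (transpose H ** S ** H)"
    by (simp add: transpose_add transpose_scalar matrix_transpose_mul matrix_mul_assoc)
next
  fix x :: "real^'n" assume "x \<noteq> 0"
  then have "0 < x \<bullet> (P *v x)" using P by (simp add: sym_pos_def_def)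
  moreover have "x \<bullet> ((transpose H ** S ** H) *v x) = (H *v x) \<bullet> (S *v (H *v x))"
    using inner_matrix_vector_transpose[of "H *v x" H]
    by (metis inner_matrix_vector_transpose matrix_vector_mul_assoc transpose_transpose)
  moreover have "0 \<le> k * ((H *v x) \<bullet> (S *v (H *v x)))"
    using sym_pos_def_nonneg[OF S] k by simp
  ultimately show "0 < x \<bullet> ((P + k *\<^sub>R (transpose H ** S ** H)) *v x)"
    by (simp add: matrix_vector_mult_add_rdistrib inner_add_right flip: scaleR_matrix_vector_assoc)
qed

section \<open>Gaussian measures with a given precision matrix\<close>

lemma integrable_exp_neg_norm_square:
  assumes c: "c > 0"
  shows "integrable lborel (\<lambda>x::'a::euclidean_space. exp (- c * (norm x)\<^sup>2))"
proof -
  interpret product_sigma_finite "\<lambda>_::'a. lborel :: real measure" ..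
  \<comment> \<open>A normal density of variance \<open>1 / (2 * c)\<close>, rescaled so that its
    normalising factor \<open>sqrt (c / pi)\<close> cancels.\<close>
  have "integrable lborel (\<lambda>t. sqrt (pi / c) * normal_density 0 (1 / sqrt (2 * c)) t)"
    using c by (intro integrable_mult_right integrable_normal_density) simp
  also have "(\<lambda>t. sqrt (pi / c) * normal_density 0 (1 / sqrt (2 * c)) t) = (\<lambda>t. exp (- c * t\<^sup>2))"
    using c by (auto simp: normal_density_def fun_eq_iff power_divide real_sqrt_divide)
  finally have "integrable (Pi\<^sub>M Basis (\<lambda>_::'a. lborel)) (\<lambda>f. \<Prod>b\<in>Basis. exp (- c * (f b)\<^sup>2))"
    by (intro product_integrable_prod) auto
  moreover have "(\<Prod>b\<in>Basis. exp (- c * (f b)\<^sup>2)) = exp (- c * (norm (\<Sum>b\<in>Basis. f b *\<^sub>R b :: 'a))\<^sup>2)" for f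
  proof -
    have "(norm (\<Sum>b\<in>Basis. f b *\<^sub>R b :: 'a))\<^sup>2 = (\<Sum>b\<in>Basis. (f b)\<^sup>2)"
      unfolding power2_norm_eq_inner by (subst euclidean_inner) (simp add: power2_eq_square)
    then show ?thesis by (simp add: exp_sum sum_distrib_left)
  qed
  ultimately show ?thesis
    unfolding lborel_eq[where 'a='a] by (subst integrable_distr_eq) simp_all
qed

text \<open>Half of the quadratic decay absorbs the linear term: expanding the nonnegative
  \<open>(b - c * t)\<^sup>2 / (2 * c)\<close> shows that this costs only a constant factor.\<close>

lemma integrable_exp_norm_quadratic:
  assumes c: "c > 0"
  shows "integrable lborel (\<lambda>x::'a::euclidean_space. exp (b * norm x - c * (norm x)\<^sup>2))"
proof (rule Bochner_Integration.integrable_bound)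
  show "integrable lborel (\<lambda>x::'a. exp (b\<^sup>2 / (2 * c)) * exp (- (c/2) * (norm x)\<^sup>2))"
    using c by (intro integrable_mult_right integrable_exp_neg_norm_square) simp
  have "b * t - c * t\<^sup>2 \<le> b\<^sup>2 / (2 * c) - c / 2 * t\<^sup>2" for t
  proof -
    have "0 \<le> (b - c * t)\<^sup>2 / (2 * c)" using c by simp
    also have "\<dots> = b\<^sup>2 / (2 * c) - c / 2 * t\<^sup>2 - (b * t - c * t\<^sup>2)"
      using c by (simp add: field_simps power2_eq_square)
    finally show ?thesis by simp
  qed
  then show "AE x::'a in lborel. norm (exp (b * norm x - c * (norm x)\<^sup>2)) \<le> norm (exp (b\<^sup>2 / (2 * c)) * exp (- (c/2) * (norm x)\<^sup>2))"
    by (simp flip: exp_add)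
qed auto

text \<open>Parametrised by the precision matrix rather than the covariance, because precisions add
  when likelihoods are multiplied.\<close>

definition gauss_kernel :: "real^'n^'n \<Rightarrow> real^'n \<Rightarrow> real" where
  "gauss_kernel P x = exp (- (1/2) * (x \<bullet> (P *v x)))"

definition gauss_mass :: "real^'n^'n \<Rightarrow> real" where
  "gauss_mass P = (\<integral>x. gauss_kernel P x \<partial>lborel)"

definition gauss_measure :: "real^'n^'n \<Rightarrow> (real^'n) measure" where
  "gauss_measure P = density lborel (\<lambda>x. ennreal (gauss_kernel P x / gauss_mass P))"

lemma continuous_gauss_kernel: "continuous_on UNIV (gauss_kernel P)"
  unfolding gauss_kernel_def by (intro continuous_intros)

lemma measurable_gauss_kernel[measurable]: "gauss_kernel P \<in> borel_measurable borel"
  by (rule borel_measurable_continuous_onI[OF continuous_gauss_kernel])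

lemma gauss_kernel_pos: "0 < gauss_kernel P x"
  by (simp add: gauss_kernel_def)

lemma gauss_kernel_uminus: "gauss_kernel P (- x) = gauss_kernel P x"
  by (simp add: gauss_kernel_def vec.neg)

text \<open>Coercivity bounds the kernel by \<open>exp (- c / 2 * (norm x)\<^sup>2)\<close>, which
  beats any exponential growth.\<close>

lemma integrable_exp_norm_gauss_kernel:
  assumes P: "sym_pos_def P"
  shows "integrable lborel (\<lambda>x. exp (b * norm x) * gauss_kernel P x)"
proof -
  obtain c where c: "c > 0" "\<And>x. c * (norm x)\<^sup>2 \<le> x \<bullet> (P *v x)"
    using sym_pos_def_coercive[OF P] by blast
  show ?thesis
  proof (rule Bochner_Integration.integrable_bound[OF integrable_exp_norm_quadratic[of "c/2" b]])
    show "AE x in lborel. norm (exp (b * norm x) * gauss_kernel P x) \<le> norm (exp (b * norm x - c / 2 * (norm x)\<^sup>2))"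
      using c(2) by (simp add: gauss_kernel_def flip: exp_add)
  qed (use c in auto)
qed

text \<open>The common domination criterion: it covers the moments as well as the exponentially
  tilted integrands of the second-moment argument.\<close>

lemma integrable_gauss_kernel_mult:
  fixes g :: "real^'n \<Rightarrow> real"
  assumes P: "sym_pos_def P" and [measurable]: "g \<in> borel_measurable borel"
    and bound: "\<And>x. \<bar>g x\<bar> \<le> D * exp (b * norm x)"
  shows "integrable lborel (\<lambda>x. g x * gauss_kernel P x)"
proof (rule Bochner_Integration.integrable_bound[OF integrable_mult_right[OF integrable_exp_norm_gauss_kernel[OF P, of b], of D]])
  show "AE x in lborel. norm (g x * gauss_kernel P x) \<le> norm (D * (exp (b * norm x) * gauss_kernel P x))"
  proof (rule AE_I2)
    fix x
    have "\<bar>g x\<bar> * gauss_kernel P x \<le> (D * exp (b * norm x)) * gauss_kernel P x"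
      using gauss_kernel_pos[of P x] by (intro mult_right_mono bound) simp
    also have "\<dots> \<le> (\<bar>D\<bar> * exp (b * norm x)) * gauss_kernel P x"
      using gauss_kernel_pos[of P x] by (intro mult_right_mono) auto
    finally show "norm (g x * gauss_kernel P x) \<le> norm (D * (exp (b * norm x) * gauss_kernel P x))"
      using gauss_kernel_pos[of P x] by (simp add: abs_mult)
  qed
qed simp

lemma gauss_mass_pos:
  fixes P :: "real^'n^'n"
  assumes P: "sym_pos_def P"
  shows "0 < gauss_mass P"
proof -
  have int: "integrable lborel (gauss_kernel P)"
    using integrable_exp_norm_gauss_kernel[OF P, of 0] by simp
  \<comment> \<open>The whole space is not a null set, so a strictly positive function cannot vanish
    almost everywhere.\<close>
  have "\<not> (AE x::real^'n in lborel. x \<notin> UNIV)"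
    using AE_iff_null_sets[of "UNIV :: (real^'n) set" lborel] by (auto simp: null_sets_def)
  then have "\<not> (AE x in lborel. gauss_kernel P x = 0)"
    using gauss_kernel_pos[of P] by (simp add: less_imp_neq[THEN not_sym])
  then have "gauss_mass P \<noteq> 0"
    unfolding gauss_mass_def
    by (subst integral_nonneg_eq_0_iff_AE[OF int]) (auto simp: gauss_kernel_pos less_imp_le)
  moreover have "gauss_mass P \<ge> 0"
    unfolding gauss_mass_def by (intro Bochner_Integration.integral_nonneg) (simp add: gauss_kernel_pos less_imp_le)
  ultimately show ?thesis by simp
qed

lemma prob_space_gauss_measure:
  assumes P: "sym_pos_def P"
  shows "prob_space (gauss_measure P)"
proof
  have int: "integrable lborel (gauss_kernel P)"
    using integrable_exp_norm_gauss_kernel[OF P, of 0] by simp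
  have "emeasure (gauss_measure P) (space (gauss_measure P)) = (\<integral>\<^sup>+x. ennreal (gauss_kernel P x / gauss_mass P) \<partial>lborel)"
    by (simp add: gauss_measure_def emeasure_density)
  also have "\<dots> = ennreal (\<integral>x. gauss_kernel P x / gauss_mass P \<partial>lborel)"
    using int gauss_kernel_pos[of P] gauss_mass_pos[OF P]
    by (intro nn_integral_eq_integral) (auto intro!: less_imp_le)
  also have "\<dots> = 1"
    using gauss_mass_pos[OF P] by (simp add: gauss_mass_def)
  finally show "emeasure (gauss_measure P) (space (gauss_measure P)) = 1" .
qed

lemma sets_gauss_measure[measurable_cong, simp]: "sets (gauss_measure P) = sets borel"
  by (simp add: gauss_measure_def)

lemma space_gauss_measure[simp]: "space (gauss_measure P) = UNIV"
  by (simp add: gauss_measure_def)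


lemma integral_gauss_measure:
  assumes P: "sym_pos_def P" and [measurable]: "g \<in> borel_measurable borel"
  shows "(\<integral>x. g x \<partial>gauss_measure P) = (\<integral>x. g x * gauss_kernel P x \<partial>lborel) / gauss_mass P"
  using gauss_kernel_pos[of P] gauss_mass_pos[OF P] unfolding gauss_measure_def
  by (subst integral_density) (auto intro!: less_imp_le simp: mult.commute simp flip: integral_divide_zero)

lemma integrable_gauss_measure:
  fixes g :: "real^'n \<Rightarrow> real"
  assumes P: "sym_pos_def P" and [measurable]: "g \<in> borel_measurable borel"
    and bound: "\<And>x. \<bar>g x\<bar> \<le> D * exp (b * norm x)"
  shows "integrable (gauss_measure P) g"
  using gauss_kernel_pos[of P] gauss_mass_pos[OF P] integrable_gauss_kernel_mult[OF assms]
  unfolding gauss_measure_def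
  by (subst integrable_density) (auto intro!: less_imp_le simp: mult.commute)

lemma norm_le_exp: "norm x \<le> exp (norm x)"
  using exp_ge_add_one_self[of "norm x"] by linarith

lemma abs_inner_le_exp: "\<bar>a \<bullet> x\<bar> \<le> norm a * exp (1 * norm x)"
  using Cauchy_Schwarz_ineq2[of a x] mult_left_mono[OF norm_le_exp[of x], of "norm a"] by simp

lemma abs_inner_mult_le_exp: "\<bar>(a \<bullet> x) * (b \<bullet> x)\<bar> \<le> norm a * norm b * exp (2 * norm x)"
proof -
  have "\<bar>(a \<bullet> x) * (b \<bullet> x)\<bar> \<le> (norm a * exp (1 * norm x)) * (norm b * exp (1 * norm x))"
    unfolding abs_mult by (intro mult_mono abs_inner_le_exp) auto
  then show ?thesis by (simp add: mult_exp_exp mult_ac)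
qed

text \<open>Both signs come from \<open>1 + w \<le> exp w\<close>. The bound is meant for difference
  quotients of \<open>exp\<close>, which it dominates uniformly near 0.\<close>

lemma abs_exp_minus_one_le: "\<bar>exp w - 1\<bar> \<le> \<bar>w\<bar> * exp \<bar>w\<bar>" for w :: real
proof (cases "w \<ge> 0")
  case True
  have "1 - w \<le> exp (- w)" using exp_ge_add_one_self[of "-w"] by simp
  then have "(1 - w) * exp w \<le> exp (- w) * exp w" by (intro mult_right_mono) auto
  with True show ?thesis by (simp add: mult_exp_exp algebra_simps)
next
  case False
  have "1 - exp w \<le> - w" using exp_ge_add_one_self[of w] by linarith
  also have "- w \<le> - w * exp (- w)" using False by simp
  finally show ?thesis using False by simp
qed

section \<open>Symmetries of Lebesgue measure and the moments of the centred Gaussian\<close>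

lemma lborel_integral_translate:
  fixes h :: "'a::euclidean_space \<Rightarrow> real"
  assumes [measurable]: "h \<in> borel_measurable borel"
  shows "(\<integral>x. h (c + x) \<partial>lborel) = (\<integral>x. h x \<partial>lborel)"
  by (subst (2) lborel_distr_plus[of c, symmetric]) (simp add: integral_distr)

lemma lborel_distr_uminus_euclidean: "distr lborel borel uminus = (lborel :: 'a::euclidean_space measure)"
  using lborel_affine[of "-1" "0 :: 'a"] by (simp add: density_1)

text \<open>The integrand is odd against an even kernel, and Lebesgue measure is invariant under
  reflection.\<close>

lemma integral_inner_gauss_measure:
  assumes P: "sym_pos_def P"
  shows "(\<integral>x. a \<bullet> x \<partial>gauss_measure P) = 0"
proof -
  have "(\<integral>x. (a \<bullet> x) * gauss_kernel P x \<partial>lborel) = (\<integral>x. (a \<bullet> (- x)) * gauss_kernel P (- x) \<partial>lborel)"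
    using integral_distr[of uminus lborel borel "\<lambda>x. (a \<bullet> x) * gauss_kernel P x"]
    by (simp add: lborel_distr_uminus_euclidean)
  then have "(\<integral>x. (a \<bullet> x) * gauss_kernel P x \<partial>lborel) = 0"
    by (simp add: gauss_kernel_uminus)
  then show ?thesis by (simp add: integral_gauss_measure[OF P])
qed

text \<open>Self-adjointness of \<open>P\<close> merges the two cross terms, so a shift of the
  kernel along \<open>v\<close> becomes an exponential tilt in the direction
  \<open>P *v v\<close>.\<close>

lemma gauss_kernel_translate:
  assumes P: "sym_pos_def P"
  shows "gauss_kernel P (t *\<^sub>R v + x) =
    exp (- (t\<^sup>2 / 2) * (v \<bullet> (P *v v))) * exp (- t * ((P *v v) \<bullet> x)) * gauss_kernel P x"
  using sym_pos_def_self_adjoint[OF P, of v x]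
  by (simp add: gauss_kernel_def matrix_vector_right_distrib matrix_vector_mult_scaleR inner_add_left
      inner_add_right power2_eq_square inner_commute algebra_simps flip: exp_add)

text \<open>Differentiating \<open>t \<mapsto> \<integral> (a \<bullet> x) G (x + t v) dx\<close> at \<open>0\<close>, where \<open>G\<close> is the kernel, in two ways
  (under the integral, and after translating \<open>x\<close> by \<open>t v\<close>) gives the second moments without
  diagonalising \<open>P\<close>.\<close>
lemma gauss_measure_second_moment:
  assumes P: "sym_pos_def P"
  shows "(\<integral>x. (a \<bullet> x) * ((P *v v) \<bullet> x) \<partial>gauss_measure P) = a \<bullet> v"
proof -
  let ?G = "gauss_kernel P" and ?C = "gauss_mass P" and ?u = "P *v v" and ?q = "v \<bullet> (P *v v)"
  let ?t = "\<lambda>n. inverse (real (Suc n))"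
  have int1: "integrable lborel (\<lambda>x. (c \<bullet> x) * ?G x)" for c
    by (rule integrable_gauss_kernel_mult[OF P _ abs_inner_le_exp]) simp
  have int0: "integrable lborel ?G"
    using integrable_exp_norm_gauss_kernel[OF P, of 0] by simp
  have mean0: "(\<integral>x. (a \<bullet> x) * ?G x \<partial>lborel) = 0"
    using integral_inner_gauss_measure[OF P, of a] gauss_mass_pos[OF P]
    by (simp add: integral_gauss_measure[OF P])
  \<comment> \<open>Uniform in \<open>t\<close> on \<open>(0, 1]\<close>, as dominated convergence
    requires: the rate 2 absorbs the two linear factors and \<open>norm ?u\<close> the remaining
    exponential.\<close>
  have bound: "\<bar>(a \<bullet> x) * ((exp (- t * (?u \<bullet> x)) - 1) / t)\<bar> \<le> norm a * norm ?u * exp ((2 + norm ?u) * norm x)"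
    if t: "0 < t" "t \<le> 1" for t x
  proof -
    have "\<bar>exp (- t * (?u \<bullet> x)) - 1\<bar> \<le> t * \<bar>?u \<bullet> x\<bar> * exp (t * \<bar>?u \<bullet> x\<bar>)"
      using abs_exp_minus_one_le[of "- t * (?u \<bullet> x)"] t by (simp add: abs_mult)
    also have "\<dots> \<le> t * \<bar>?u \<bullet> x\<bar> * exp (norm ?u * norm x)"
    proof (intro mult_left_mono)
      have "t * \<bar>?u \<bullet> x\<bar> \<le> \<bar>?u \<bullet> x\<bar>" using t by (simp add: mult_left_le_one_le)
      also have "\<dots> \<le> norm ?u * norm x" by (rule Cauchy_Schwarz_ineq2)
      finally show "exp (t * \<bar>?u \<bullet> x\<bar>) \<le> exp (norm ?u * norm x)" by simp
    qed (use t in auto)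
    finally have "\<bar>(exp (- t * (?u \<bullet> x)) - 1) / t\<bar> \<le> \<bar>?u \<bullet> x\<bar> * exp (norm ?u * norm x)"
      using t by (simp add: field_simps)
    then have "\<bar>(a \<bullet> x) * ((exp (- t * (?u \<bullet> x)) - 1) / t)\<bar> \<le> \<bar>(a \<bullet> x) * (?u \<bullet> x)\<bar> * exp (norm ?u * norm x)"
      unfolding abs_mult[of "a \<bullet> x"] mult.assoc by (rule mult_left_mono) simp
    also have "\<dots> \<le> (norm a * norm ?u * exp (2 * norm x)) * exp (norm ?u * norm x)"
      by (intro mult_right_mono abs_inner_mult_le_exp) simp
    finally show ?thesis by (simp add: mult_exp_exp algebra_simps)
  qed
  \<comment> \<open>The integrated difference quotient has a closed form for each
    \<open>t > 0\<close>, because the tilted kernel is a translate of the original one.\<close>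
  have translated: "(\<integral>x. (a \<bullet> x) * ((exp (- t * (?u \<bullet> x)) - 1) / t) * ?G x \<partial>lborel)
      = - (a \<bullet> v) * ?C * exp (t\<^sup>2 / 2 * ?q)" if t: "0 < t" for t
  proof -
    have int: "integrable lborel (\<lambda>x. (a \<bullet> x) * exp (- t * (?u \<bullet> x)) * ?G x)"
    proof (rule integrable_gauss_kernel_mult[OF P])
      fix x
      have "- t * (?u \<bullet> x) \<le> t * norm ?u * norm x"
      proof -
      have "\<bar>t * (?u \<bullet> x)\<bar> \<le> t * (norm ?u * norm x)"
        unfolding abs_mult using t by (intro mult_mono Cauchy_Schwarz_ineq2) auto
      then show ?thesis by (simp add: mult.assoc)
    qed
      then have "\<bar>a \<bullet> x\<bar> * exp (- t * (?u \<bullet> x)) \<le> (norm a * exp (1 * norm x)) * exp (t * norm ?u * norm x)"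
        by (intro mult_mono abs_inner_le_exp) auto
      then show "\<bar>(a \<bullet> x) * exp (- t * (?u \<bullet> x))\<bar> \<le> norm a * exp ((1 + t * norm ?u) * norm x)"
        by (simp add: abs_mult mult_exp_exp algebra_simps)
    qed simp
    \<comment> \<open>Writing \<open>x\<close> as \<open>(t *\<^sub>R v + x) - t *\<^sub>R v\<close>
      makes the integrand a function of \<open>t *\<^sub>R v + x\<close> alone, so translation
      invariance applies.\<close>
    have "exp (- (t\<^sup>2 / 2) * ?q) * (\<integral>x. (a \<bullet> x) * exp (- t * (?u \<bullet> x)) * ?G x \<partial>lborel)
        = (\<integral>x. (a \<bullet> ((t *\<^sub>R v + x) - t *\<^sub>R v)) * ?G (t *\<^sub>R v + x) \<partial>lborel)"
      unfolding gauss_kernel_translate[OF P] integral_mult_right_zero[symmetric]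
      by (intro Bochner_Integration.integral_cong) auto
    also have "\<dots> = (\<integral>x. (a \<bullet> (x - t *\<^sub>R v)) * ?G x \<partial>lborel)"
      by (rule lborel_integral_translate) simp
    also have "\<dots> = (\<integral>x. (a \<bullet> x) * ?G x - t * (a \<bullet> v) * ?G x \<partial>lborel)"
      by (simp add: inner_diff_right algebra_simps)
    also have "\<dots> = - t * (a \<bullet> v) * ?C"
      using int0 int1 by (simp add: mean0 gauss_mass_def)
    finally have *: "(\<integral>x. (a \<bullet> x) * exp (- t * (?u \<bullet> x)) * ?G x \<partial>lborel) = - t * (a \<bullet> v) * ?C * exp (t\<^sup>2 / 2 * ?q)"
      by (simp add: exp_minus field_simps)
    have "(\<integral>x. (a \<bullet> x) * ((exp (- t * (?u \<bullet> x)) - 1) / t) * ?G x \<partial>lborel)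
        = (\<integral>x. ((a \<bullet> x) * exp (- t * (?u \<bullet> x)) * ?G x - (a \<bullet> x) * ?G x) / t \<partial>lborel)"
      by (intro Bochner_Integration.integral_cong) (auto simp: field_simps)
    also have "\<dots> = ((\<integral>x. (a \<bullet> x) * exp (- t * (?u \<bullet> x)) * ?G x \<partial>lborel) - (\<integral>x. (a \<bullet> x) * ?G x \<partial>lborel)) / t"
      unfolding integral_divide_zero using int int1 by (subst Bochner_Integration.integral_diff) auto
    also have "\<dots> = (- t * (a \<bullet> v) * ?C * exp (t\<^sup>2 / 2 * ?q) - 0) / t"
      by (simp only: * mean0)
    finally show ?thesis using t by simp
  qed
  have t_pos: "0 < ?t n" for n by simp
  \<comment> \<open>The sequence \<open>?t n = 1 / (n + 1)\<close> tends to 0 inside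
    \<open>(0, 1]\<close>, the range in which \<open>bound\<close> holds.\<close>
  have "(\<lambda>n. \<integral>x. (a \<bullet> x) * ((exp (- ?t n * (?u \<bullet> x)) - 1) / ?t n) * ?G x \<partial>lborel)
      \<longlonglongrightarrow> (\<integral>x. (a \<bullet> x) * (- (?u \<bullet> x)) * ?G x \<partial>lborel)"
  proof (rule integral_dominated_convergence)
    show "integrable lborel (\<lambda>x. norm a * norm ?u * exp ((2 + norm ?u) * norm x) * ?G x)"
      by (rule integrable_gauss_kernel_mult[OF P, where D="norm a * norm ?u"]) auto
    have "((\<lambda>t. (exp (- t * s) - 1) / t) \<longlongrightarrow> - s) (at 0)" for s :: real
    proof -
      have "((\<lambda>t. exp (- t * s)) has_real_derivative - s) (at 0)"
        by (auto intro!: derivative_eq_intros)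
      then show ?thesis by (simp add: has_field_derivative_iff)
    qed
    moreover have "filterlim ?t (at 0) sequentially"
      unfolding filterlim_at using LIMSEQ_inverse_real_of_nat by auto
    ultimately have "(\<lambda>n. (exp (- ?t n * s) - 1) / ?t n) \<longlonglongrightarrow> - s" for s
      by (rule filterlim_compose)
    then show "AE x in lborel. (\<lambda>n. (a \<bullet> x) * ((exp (- ?t n * (?u \<bullet> x)) - 1) / ?t n) * ?G x)
        \<longlonglongrightarrow> (a \<bullet> x) * (- (?u \<bullet> x)) * ?G x"
      by (intro AE_I2 tendsto_intros)
    fix n
    show "AE x in lborel. norm ((a \<bullet> x) * ((exp (- ?t n * (?u \<bullet> x)) - 1) / ?t n) * ?G x)
        \<le> norm a * norm ?u * exp ((2 + norm ?u) * norm x) * ?G x"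
    proof (rule AE_I2)
      fix x
      have "0 < ?t n" "?t n \<le> 1" by (auto simp: divide_simps)
      then have "\<bar>(a \<bullet> x) * ((exp (- ?t n * (?u \<bullet> x)) - 1) / ?t n)\<bar> * ?G x
          \<le> norm a * norm ?u * exp ((2 + norm ?u) * norm x) * ?G x"
        using gauss_kernel_pos[of P x] by (intro mult_right_mono bound) auto
      then show "norm ((a \<bullet> x) * ((exp (- ?t n * (?u \<bullet> x)) - 1) / ?t n) * ?G x)
          \<le> norm a * norm ?u * exp ((2 + norm ?u) * norm x) * ?G x"
        using gauss_kernel_pos[of P x] unfolding real_norm_def abs_mult[of _ "?G x"] by simp
    qed
  qed auto
  moreover have "(\<lambda>n. - (a \<bullet> v) * ?C * exp ((?t n)\<^sup>2 / 2 * ?q)) \<longlonglongrightarrow> - (a \<bullet> v) * ?C * exp (0\<^sup>2 / 2 * ?q)"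
    by (intro tendsto_intros LIMSEQ_inverse_real_of_nat) simp
  ultimately have "(\<integral>x. (a \<bullet> x) * (- (?u \<bullet> x)) * ?G x \<partial>lborel) = - (a \<bullet> v) * ?C"
    unfolding translated[OF t_pos] using LIMSEQ_unique by fastforce
  then show ?thesis
    using gauss_mass_pos[OF P] by (simp add: integral_gauss_measure[OF P])
qed


text \<open>A push-forward of one fixed measure under translation: when only the centre varies,
  kernel measurability and weak continuity become statements about the map \<open>m\<close>.\<close>

definition gauss_shift :: "real^'n \<Rightarrow> real^'n^'n \<Rightarrow> (real^'n) measure" where
  "gauss_shift m P = distr (gauss_measure P) borel (\<lambda>x. m + x)"

lemma measurable_matrix_vector_mult[measurable (raw)]:
  fixes A :: "real^'n^'m"
  assumes [measurable]: "f \<in> borel_measurable M"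
  shows "(\<lambda>x. A *v f x) \<in> borel_measurable M"
proof -
  have [measurable]: "(\<lambda>x. A *v x) \<in> borel_measurable borel"
    by (intro borel_measurable_continuous_onI continuous_intros)
  show ?thesis by measurable
qed

lemma sets_gauss_shift[simp, measurable_cong]: "sets (gauss_shift m P) = sets borel"
  by (simp add: gauss_shift_def)

lemma prob_space_gauss_shift: "sym_pos_def P \<Longrightarrow> prob_space (gauss_shift m P)"
  unfolding gauss_shift_def
  by (intro prob_space.prob_space_distr prob_space_gauss_measure) simp_all

lemma emeasure_gauss_shift:
  assumes P: "sym_pos_def P" and [measurable]: "A \<in> sets borel"
  shows "emeasure (gauss_shift m P) A
    = (\<integral>\<^sup>+x. ennreal (gauss_kernel P (x - m) / gauss_mass P) * indicator A x \<partial>lborel)"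
proof -
  have "emeasure (gauss_shift m P) A = (\<integral>\<^sup>+x. indicator A (m + x) \<partial>gauss_measure P)"
    using nn_integral_distr[of "\<lambda>x. m + x" "gauss_measure P" borel "indicator A"]
    by (simp add: gauss_shift_def)
  also have "\<dots> = (\<integral>\<^sup>+x. ennreal (gauss_kernel P x / gauss_mass P) * indicator A (m + x) \<partial>lborel)"
    unfolding gauss_measure_def by (subst nn_integral_density) simp_all
  also have "\<dots> = (\<integral>\<^sup>+x. ennreal (gauss_kernel P (x - m) / gauss_mass P) * indicator A x \<partial>lborel)"
    by (subst (2) lborel_distr_plus[of m, symmetric]) (simp add: nn_integral_distr)
  finally show ?thesis .
qed

lemma integral_gauss_shift:
  fixes g :: "real^'n \<Rightarrow> 'b::{banach, second_countable_topology}"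
  assumes "g \<in> borel_measurable borel"
  shows "(\<integral>x. g x \<partial>gauss_shift m P) = (\<integral>x. g (m + x) \<partial>gauss_measure P)"
  using assms by (simp add: gauss_shift_def integral_distr)

lemma integrable_gauss_measure_id:
  fixes P :: "real^'n^'n"
  assumes P: "sym_pos_def P"
  shows "integrable (gauss_measure P) (\<lambda>x. x)"
proof (rule integrable_norm_cancel)
  show "integrable (gauss_measure P) (\<lambda>x. norm x)"
    using norm_le_exp by (intro integrable_gauss_measure[OF P, where D=1 and b=1]) auto
qed simp

lemma mean_vector_gauss_shift:
  assumes P: "sym_pos_def P"
  shows "mean_vector (gauss_shift m P) = m"
proof -
  interpret prob_space "gauss_measure P" by (rule prob_space_gauss_measure[OF P])
  have int: "integrable (gauss_measure P) (\<lambda>x. x)" by (rule integrable_gauss_measure_id[OF P])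
  have "a \<bullet> (\<integral>x. x \<partial>gauss_measure P) = 0" for a
    using integral_inner_gauss_measure[OF P, of a] integral_inner_right[of a "gauss_measure P" "\<lambda>x. x"] int
    by simp
  then have "(\<integral>x. x \<partial>gauss_measure P) = 0" using inner_eq_zero_iff by blast
  with int have "(\<integral>x. m + x \<partial>gauss_measure P) = m"
    using prob_space by simp
  then show ?thesis by (simp add: mean_vector_def integral_gauss_shift)
qed

lemma covariance_matrix_gauss_shift:
  assumes P: "sym_pos_def P"
  shows "covariance_matrix (gauss_shift m P) = matrix_inv P"
proof -
  have "(\<integral>x. (x $ i - m $ i) * (x $ j - m $ j) \<partial>gauss_shift m P) = matrix_inv P $ i $ j" for i j
  proof -
    \<comment> \<open>The vector \<open>axis j 1\<close> is written as \<open>P *v v\<close> with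
      \<open>v = matrix_inv P *v axis j 1\<close>, the form that the second-moment identity
      expects.\<close>
    have "(\<integral>x. (x $ i - m $ i) * (x $ j - m $ j) \<partial>gauss_shift m P)
        = (\<integral>x. (axis i 1 \<bullet> x) * ((P *v (matrix_inv P *v axis j 1)) \<bullet> x) \<partial>gauss_measure P)"
      by (subst integral_gauss_shift)
         (simp_all add: sym_pos_def_matrix_inv_cancel[OF P] inner_axis inner_axis')
    also have "\<dots> = matrix_inv P $ i $ j"
      by (subst gauss_measure_second_moment[OF P])
         (simp add: inner_axis' matrix_vector_mult_basis column_def)
    finally show ?thesis .
  qed
  then show ?thesis by (simp add: covariance_matrix_def mean_vector_gauss_shift[OF P] vec_eq_iff)
qed

text \<open>Guarantees that the integrals behind mean and covariance are genuine, since a Bochner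
  integral is 0 by convention when it does not exist.\<close>

lemma integrable_norm_square_gauss_shift:
  assumes P: "sym_pos_def P"
  shows "integrable (gauss_shift m P) (\<lambda>x. (norm x)\<^sup>2)"
proof -
  have "integrable (gauss_measure P) (\<lambda>x. (norm (m + x))\<^sup>2)"
  proof (rule integrable_gauss_measure[OF P])
    fix x
    have "norm (m + x) \<le> exp (norm m + norm x)"
      using norm_le_exp[of "m + x"] norm_triangle_ineq[of m x] by (smt (verit) exp_le_cancel_iff)
    then have "(norm (m + x))\<^sup>2 \<le> (exp (norm m + norm x))\<^sup>2"
      by (intro power_mono) auto
    then show "\<bar>(norm (m + x))\<^sup>2\<bar> \<le> exp (2 * norm m) * exp (2 * norm x)"
      by (simp add: power2_eq_square mult_exp_exp algebra_simps)
  qed simp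
  then show ?thesis by (simp add: gauss_shift_def integrable_distr_eq)
qed

text \<open>The measure stays fixed while the argument of \<open>g\<close> moves, so dominated
  convergence with the constant bound of \<open>g\<close> suffices.\<close>

lemma continuous_on_gauss_shift:
  fixes g :: "real^'n \<Rightarrow> real"
  assumes P: "sym_pos_def P" and g: "continuous_on UNIV g" "bounded (range g)"
    and m: "continuous_on S m"
  shows "continuous_on S (\<lambda>z. \<integral>x. g x \<partial>gauss_shift (m z) P)"
proof -
  interpret prob_space "gauss_measure P" by (rule prob_space_gauss_measure[OF P])
  have [measurable]: "g \<in> borel_measurable borel"
    using g(1) by (rule borel_measurable_continuous_onI)
  obtain B where B: "\<And>x. norm (g x) \<le> B"
    using g(2) by (auto simp: bounded_iff)
  have "isCont (\<lambda>v. \<integral>x. g (v + x) \<partial>gauss_measure P) v" for v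
    unfolding continuous_at_sequentially comp_def
  proof (intro allI impI)
    fix w assume w: "w \<longlonglongrightarrow> v"
    show "(\<lambda>n. \<integral>x. g (w n + x) \<partial>gauss_measure P) \<longlonglongrightarrow> (\<integral>x. g (v + x) \<partial>gauss_measure P)"
    proof (rule integral_dominated_convergence[where w="\<lambda>_. B"])
      show "AE x in gauss_measure P. (\<lambda>n. g (w n + x)) \<longlonglongrightarrow> g (v + x)"
        using g(1) w by (intro AE_I2 isCont_tendsto_compose[where g=g] tendsto_intros)
          (auto simp: continuous_on_eq_continuous_at)
    qed (use B in auto)
  qed
  then have "continuous_on UNIV (\<lambda>v. \<integral>x. g (v + x) \<partial>gauss_measure P)"
    by (simp add: continuous_on_eq_continuous_at)
  from continuous_on_compose2[OF this m] show ?thesis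
    by (simp add: integral_gauss_shift)
qed

section \<open>Uniqueness of weakly continuous conditional distributions\<close>

lemma kernel_sets:
  assumes "\<kappa> \<in> D \<rightarrow>\<^sub>M prob_algebra L" "z \<in> space D"
  shows "sets (\<kappa> z) = sets L" "prob_space (\<kappa> z)" "space (\<kappa> z) = space L"
proof -
  have "\<kappa> z \<in> space (prob_algebra L)"
    using assms by (rule measurable_space)
  then show sets: "sets (\<kappa> z) = sets L" and "prob_space (\<kappa> z)"
    by (auto simp: space_prob_algebra)
  from sets show "space (\<kappa> z) = space L" by (rule sets_eq_imp_space_eq)
qed

text \<open>The exceptional set may depend on \<open>g\<close>. Building \<open>g\<close> from
  indicators by sums, multiples and monotone limits merges only countably many null sets, so
  \<open>L\<close> need not be countably generated.\<close>

lemma AE_nn_integral_kernel_eq: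
  assumes D: "finite_measure D"
    and \<kappa>: "\<kappa> \<in> D \<rightarrow>\<^sub>M prob_algebra L" and \<kappa>': "\<kappa>' \<in> D \<rightarrow>\<^sub>M prob_algebra L"
    and eq: "\<And>A B. A \<in> sets L \<Longrightarrow> B \<in> sets D \<Longrightarrow>
      (\<integral>\<^sup>+z. emeasure (\<kappa> z) A * indicator B z \<partial>D) = (\<integral>\<^sup>+z. emeasure (\<kappa>' z) A * indicator B z \<partial>D)"
    and g: "g \<in> borel_measurable L"
  shows "AE z in D. (\<integral>\<^sup>+x. g x \<partial>\<kappa> z) = (\<integral>\<^sup>+x. g x \<partial>\<kappa>' z)"
  using g
proof (induction rule: borel_measurable_induct)
  case (cong f g)
  have "(\<integral>\<^sup>+x. f x \<partial>\<kappa> z) = (\<integral>\<^sup>+x. g x \<partial>\<kappa> z)" "(\<integral>\<^sup>+x. f x \<partial>\<kappa>' z) = (\<integral>\<^sup>+x. g x \<partial>\<kappa>' z)"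
    if "z \<in> space D" for z
    using kernel_sets[OF \<kappa> that] kernel_sets[OF \<kappa>' that] cong.hyps by (auto intro!: nn_integral_cong)
  with cong.IH show ?case by (auto elim: AE_mp)
next
  case (set A)
  \<comment> \<open>For fixed \<open>A\<close> both functions of \<open>z\<close> have the same
    integral over every \<open>B\<close>, hence are densities of the same measure.\<close>
  have "AE z in D. emeasure (\<kappa> z) A = emeasure (\<kappa>' z) A"
    using measurable_prob_algebraD[OF \<kappa>] measurable_prob_algebraD[OF \<kappa>'] set eq
    by (intro finite_measure.density_unique_finite_measure[OF D])
       (auto intro: measurable_emeasure_kernel)
  then show ?case
    by (rule AE_mp) (auto intro!: AE_I2 simp: kernel_sets[OF \<kappa>] kernel_sets[OF \<kappa>'] set)
next
  case (mult u c)
  have "(\<integral>\<^sup>+x. c * u x \<partial>\<kappa> z) = c * (\<integral>\<^sup>+x. u x \<partial>\<kappa> z)" "(\<integral>\<^sup>+x. c * u x \<partial>\<kappa>' z) = c * (\<integral>\<^sup>+x. u x \<partial>\<kappa>' z)"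
    if "z \<in> space D" for z
    using mult.hyps by (intro nn_integral_cmult; simp cong: measurable_cong_sets add: kernel_sets[OF \<kappa> that] kernel_sets[OF \<kappa>' that])+
  with mult.IH show ?case by (auto elim: AE_mp)
next
  case (add u v)
  have "(\<integral>\<^sup>+x. v x + u x \<partial>\<kappa> z) = (\<integral>\<^sup>+x. v x \<partial>\<kappa> z) + (\<integral>\<^sup>+x. u x \<partial>\<kappa> z)"
    "(\<integral>\<^sup>+x. v x + u x \<partial>\<kappa>' z) = (\<integral>\<^sup>+x. v x \<partial>\<kappa>' z) + (\<integral>\<^sup>+x. u x \<partial>\<kappa>' z)"
    if "z \<in> space D" for z
    using add.hyps by (intro nn_integral_add; simp cong: measurable_cong_sets add: kernel_sets[OF \<kappa> that] kernel_sets[OF \<kappa>' that])+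
  with add.IH show ?case by (auto elim: AE_mp)
next
  case (seq U)
  have *: "(\<integral>\<^sup>+x. (SUP i. U i) x \<partial>\<kappa> z) = (SUP i. \<integral>\<^sup>+x. U i x \<partial>\<kappa> z)"
    "(\<integral>\<^sup>+x. (SUP i. U i) x \<partial>\<kappa>' z) = (SUP i. \<integral>\<^sup>+x. U i x \<partial>\<kappa>' z)"
    if "z \<in> space D" for z
    unfolding SUP_apply using seq.hyps
    by (intro nn_integral_monotone_convergence_SUP; simp cong: measurable_cong_sets add: kernel_sets[OF \<kappa> that] kernel_sets[OF \<kappa>' that])+
  have "AE z in D. \<forall>i. (\<integral>\<^sup>+x. U i x \<partial>\<kappa> z) = (\<integral>\<^sup>+x. U i x \<partial>\<kappa>' z)"
    using seq.IH by (simp add: AE_all_countable)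
  then show ?case by (rule AE_mp) (intro AE_I2 impI; simp only: *)
qed

text \<open>Open sets are a generator stable under intersection, and the indicator of an open
  \<open>U\<close> is the pointwise limit of the continuous functions
  \<open>min 1 (n * infdist x (- U))\<close>.\<close>

lemma finite_measure_eqI_bounded_continuous:
  fixes \<mu> \<nu> :: "'a::metric_space measure"
  assumes \<mu>: "finite_measure \<mu>" "sets \<mu> = sets borel" and \<nu>: "finite_measure \<nu>" "sets \<nu> = sets borel"
    and eq: "\<And>g::'a \<Rightarrow> real. continuous_on UNIV g \<Longrightarrow> (\<And>x. 0 \<le> g x) \<Longrightarrow> (\<And>x. g x \<le> 1) \<Longrightarrow>
      (\<integral>x. g x \<partial>\<mu>) = (\<integral>x. g x \<partial>\<nu>)"
  shows "\<mu> = \<nu>"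
proof (rule measure_eqI_generator_eq)
  interpret \<mu>: finite_measure \<mu> by fact
  interpret \<nu>: finite_measure \<nu> by fact
  note [measurable_cong] = \<mu>(2) \<nu>(2)
  have space: "space \<mu> = UNIV" "space \<nu> = UNIV"
    using \<mu>(2) \<nu>(2) by (auto dest: sets_eq_imp_space_eq)
  show "Int_stable {S::'a set. open S}" by (auto simp: Int_stable_def)
  show "sets \<mu> = sigma_sets UNIV {S. open S}" "sets \<nu> = sigma_sets UNIV {S. open S}"
    using \<mu>(2) \<nu>(2) by (auto simp: borel_def)
  show "range (\<lambda>_::nat. UNIV) \<subseteq> {S::'a set. open S}" "(\<Union>i::nat. UNIV) = (UNIV::'a set)" by auto
  show "emeasure \<mu> UNIV \<noteq> \<infinity>" by simp
  fix U :: "'a set" assume "U \<in> {S. open S}"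
  then have U: "open U" and [measurable]: "U \<in> sets borel" by auto
  have "measure \<mu> U = measure \<nu> U"
  \<comment> \<open>\<open>infdist\<close> to the empty set is 0 by convention, so the approximation
    would fail for \<open>U = UNIV\<close>.\<close>
  proof (cases "- U = {}")
    case True
    then have "U = UNIV" by auto
    with eq[of "\<lambda>_. 1"] show ?thesis by (simp add: space)
  next
    case False
    define g where "g n x = min 1 (real n * infdist x (- U))" for n x
    have cont: "continuous_on UNIV (g n)" for n
      unfolding g_def by (intro continuous_intros)
    then have [measurable]: "g n \<in> borel_measurable borel" for n
      by (rule borel_measurable_continuous_onI)
    have bounds: "0 \<le> g n x" "g n x \<le> 1" for n x by (auto simp: g_def infdist_nonneg)
    have lim: "(\<lambda>n. g n x) \<longlonglongrightarrow> indicator U x" for x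
    proof (cases "x \<in> U")
      case True
      then have "infdist x (- U) > 0"
        using U False by (metis ComplD closed_Compl in_closed_iff_infdist_zero infdist_nonneg less_eq_real_def)
      then obtain m where m: "1 < real m * infdist x (- U)"
        using reals_Archimedean3 by blast
      have "eventually (\<lambda>n. g n x = 1) sequentially"
        using eventually_ge_at_top[of m]
      proof eventually_elim
        case (elim n)
        then have "real m * infdist x (- U) \<le> real n * infdist x (- U)"
          by (intro mult_right_mono) (auto simp: infdist_nonneg)
        with m show ?case by (simp add: g_def)
      qed
      with True show ?thesis by (simp add: tendsto_eventually)
    qed (simp add: g_def)
    have "(\<lambda>n. \<integral>x. g n x \<partial>\<mu>) \<longlonglongrightarrow> (\<integral>x. indicator U x \<partial>\<mu>)"
      using lim bounds by (intro integral_dominated_convergence[where w="\<lambda>_. 1"]) auto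
    moreover have "(\<lambda>n. \<integral>x. g n x \<partial>\<nu>) \<longlonglongrightarrow> (\<integral>x. indicator U x \<partial>\<nu>)"
      using lim bounds by (intro integral_dominated_convergence[where w="\<lambda>_. 1"]) auto
    ultimately show ?thesis
      using LIMSEQ_unique by (simp add: eq[OF cont bounds] space)
  qed
  then show "emeasure \<mu> U = emeasure \<nu> U"
    by (simp add: \<mu>.emeasure_eq_measure \<nu>.emeasure_eq_measure)
qed auto

text \<open>The test function is fixed before any null set appears, so each one may have its own
  exceptional set, and the support property at the single point \<open>z\<close> is enough.\<close>

lemma weakly_continuous_conditional_distribution_unique:
  fixes \<kappa> \<kappa>' :: "'b::topological_space \<Rightarrow> 'a::metric_space measure"
  assumes M: "prob_space M" and Y[measurable]: "Y \<in> M \<rightarrow>\<^sub>M N"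
    and \<kappa>: "regular_conditional_distribution M X borel Y N \<kappa>" "weakly_continuous_on (space N) \<kappa>"
    and \<kappa>': "regular_conditional_distribution M X borel Y N \<kappa>'" "weakly_continuous_on (space N) \<kappa>'"
    and z: "z \<in> space N"
    and support: "\<And>V. open V \<Longrightarrow> z \<in> V \<Longrightarrow> \<not> (AE w in distr M N Y. w \<notin> V)"
  shows "\<kappa> z = \<kappa>' z"
proof (rule finite_measure_eqI_bounded_continuous)
  let ?D = "distr M N Y"
  interpret M: prob_space M by fact
  interpret D: prob_space ?D by (rule M.prob_space_distr) fact
  have m: "\<kappa> \<in> N \<rightarrow>\<^sub>M prob_algebra borel" "\<kappa>' \<in> N \<rightarrow>\<^sub>M prob_algebra borel"
    using \<kappa>(1) \<kappa>'(1) by (auto simp: regular_conditional_distribution_def)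
  then have m': "\<kappa> \<in> ?D \<rightarrow>\<^sub>M prob_algebra borel" "\<kappa>' \<in> ?D \<rightarrow>\<^sub>M prob_algebra borel"
    by (simp_all cong: measurable_cong_sets)
  note \<kappa>_sets = kernel_sets[OF m(1)] and \<kappa>'_sets = kernel_sets[OF m(2)]
  show "finite_measure (\<kappa> z)" "finite_measure (\<kappa>' z)"
    using \<kappa>_sets[OF z] \<kappa>'_sets[OF z] by (auto intro: prob_space.finite_measure)
  show "sets (\<kappa> z) = sets borel" "sets (\<kappa>' z) = sets borel"
    using \<kappa>_sets[OF z] \<kappa>'_sets[OF z] by auto
  fix g :: "'a \<Rightarrow> real" assume g: "continuous_on UNIV g" "\<And>x. 0 \<le> g x" "\<And>x. g x \<le> 1"
  then have [measurable]: "g \<in> borel_measurable borel"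
    by (intro borel_measurable_continuous_onI)
  have "bounded (range g)"
    using g by (auto simp: bounded_iff intro!: exI[of _ 1])
  then have "continuous_on (space N) (\<lambda>w. (\<integral>x. g x \<partial>\<kappa> w) - (\<integral>x. g x \<partial>\<kappa>' w))"
    using \<kappa>(2) \<kappa>'(2) g by (intro continuous_on_diff) (auto simp: weakly_continuous_on_def)
  \<comment> \<open>The set of disagreement is only relatively open in \<open>space N\<close>;
    \<open>T\<close> is an open set of the whole type with the same trace, as \<open>support\<close>
    asks for.\<close>
  from continuous_openin_preimage_gen[OF this, of "- {0}"]
  obtain T where T: "open T" "space N \<inter> (\<lambda>w. (\<integral>x. g x \<partial>\<kappa> w) - (\<integral>x. g x \<partial>\<kappa>' w)) -` (- {0}) = space N \<inter> T"
    by (auto simp: openin_open)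
  have "AE w in ?D. (\<integral>\<^sup>+x. ennreal (g x) \<partial>\<kappa> w) = (\<integral>\<^sup>+x. ennreal (g x) \<partial>\<kappa>' w)"
  proof (rule AE_nn_integral_kernel_eq[OF _ m'])
    show "finite_measure ?D" by unfold_locales
    fix A :: "'a set" and B assume "A \<in> sets borel" "B \<in> sets ?D"
    then show "(\<integral>\<^sup>+z. emeasure (\<kappa> z) A * indicator B z \<partial>?D) = (\<integral>\<^sup>+z. emeasure (\<kappa>' z) A * indicator B z \<partial>?D)"
      using \<kappa>(1) \<kappa>'(1) by (auto simp: regular_conditional_distribution_def)
  qed simp
  then have "AE w in ?D. (\<integral>x. g x \<partial>\<kappa> w) = (\<integral>x. g x \<partial>\<kappa>' w)"
  proof (rule AE_mp, intro AE_I2 impI)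
    fix w assume "w \<in> space ?D" and eq: "(\<integral>\<^sup>+x. ennreal (g x) \<partial>\<kappa> w) = (\<integral>\<^sup>+x. ennreal (g x) \<partial>\<kappa>' w)"
    then have w: "w \<in> space N" by simp
    show "(\<integral>x. g x \<partial>\<kappa> w) = (\<integral>x. g x \<partial>\<kappa>' w)"
      using eq g by (simp add: integral_eq_nn_integral \<kappa>_sets[OF w] \<kappa>'_sets[OF w] cong: measurable_cong_sets)
  qed
  then have "AE w in ?D. w \<notin> T"
    by (rule AE_mp) (use T(2) in \<open>auto intro!: AE_I2\<close>)
  with support[OF T(1)] have "z \<notin> T" by blast
  with T(2) z show "(\<integral>x. g x \<partial>\<kappa> z) = (\<integral>x. g x \<partial>\<kappa>' z)" by auto
qed

section \<open>The repeated linear Gaussian observation model\<close>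

lemma sets_PiM_lborel[measurable_cong]:
  "sets (\<Pi>\<^sub>M i\<in>I. (lborel :: 'a::euclidean_space measure)) = sets (\<Pi>\<^sub>M i\<in>I. borel)"
  by (rule sets_PiM_cong) auto

text \<open>Boxes determine a product of sigma-finite measures, and on a box the integral splits
  into one factor per index.\<close>

lemma density_PiM_lborel:
  fixes r :: "'a::euclidean_space \<Rightarrow> ennreal"
  assumes I: "finite I" and [measurable]: "r \<in> borel_measurable borel"
    and sf: "sigma_finite_measure (density lborel r)"
  shows "(\<Pi>\<^sub>M i\<in>I. density lborel r) = density (\<Pi>\<^sub>M i\<in>I. lborel) (\<lambda>e. \<Prod>i\<in>I. r (e i))"
proof -
  interpret L: product_sigma_finite "\<lambda>_::'b. lborel :: 'a measure" ..
  interpret R: product_sigma_finite "\<lambda>_::'b. density lborel r"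
    using sf by (simp add: product_sigma_finite_def)
  let ?L = "\<Pi>\<^sub>M i\<in>I. (lborel :: 'a measure)"
  show ?thesis
  proof (rule R.PiM_eqI[symmetric, OF I])
    show "sets (density ?L (\<lambda>e. \<Prod>i\<in>I. r (e i))) = sets (\<Pi>\<^sub>M i\<in>I. density lborel r)"
      by (auto intro!: sets_PiM_cong)
    fix A :: "'b \<Rightarrow> 'a set" assume "\<And>i. i \<in> I \<Longrightarrow> A i \<in> sets (density lborel r)"
    then have A[measurable]: "\<And>i. i \<in> I \<Longrightarrow> A i \<in> sets borel" by simp
    have "Pi\<^sub>E I A \<in> sets ?L" using I A by (intro sets_PiM_I_finite) auto
    then have "emeasure (density ?L (\<lambda>e. \<Prod>i\<in>I. r (e i))) (Pi\<^sub>E I A)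
        = (\<integral>\<^sup>+e. (\<Prod>i\<in>I. r (e i)) * indicator (Pi\<^sub>E I A) e \<partial>?L)"
      by (subst emeasure_density) auto
    also have "\<dots> = (\<integral>\<^sup>+e. (\<Prod>i\<in>I. r (e i) * indicator (A i) (e i)) \<partial>?L)"
    proof (rule nn_integral_cong)
      fix e assume "e \<in> space ?L"
      then have "indicator (Pi\<^sub>E I A) e = (\<Prod>i\<in>I. indicator (A i) (e i) :: ennreal)"
      proof (cases "e \<in> Pi\<^sub>E I A")
        case True
        then show ?thesis by (auto simp: PiE_iff)
      next
        case False
        with \<open>e \<in> space ?L\<close> obtain i where "i \<in> I" "e i \<notin> A i" by (auto simp: space_PiM PiE_iff)
        then have "(\<Prod>i\<in>I. indicator (A i) (e i) :: ennreal) = 0"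
          using I by (intro prod_zero bexI[of _ i]) auto
        with False show ?thesis by simp
      qed
      then show "(\<Prod>i\<in>I. r (e i)) * indicator (Pi\<^sub>E I A) e = (\<Prod>i\<in>I. r (e i) * indicator (A i) (e i))"
        by (simp add: prod.distrib)
    qed
    also have "\<dots> = (\<Prod>i\<in>I. \<integral>\<^sup>+x. r x * indicator (A i) x \<partial>lborel)"
      using A by (intro L.product_nn_integral_prod I) auto
    also have "\<dots> = (\<Prod>i\<in>I. emeasure (density lborel r) (A i))"
      using A by (intro prod.cong) (auto simp: emeasure_density)
    finally show "emeasure (density ?L (\<lambda>e. \<Prod>i\<in>I. r (e i))) (Pi\<^sub>E I A)
        = (\<Prod>i\<in>I. emeasure (density lborel r) (A i))" .
  qed
qed

text \<open>Provides the substitution of \<open>z i - v i\<close> for the noise at a fixed signal;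
  translation invariance is checked on boxes.\<close>

lemma nn_integral_PiM_lborel_shift:
  fixes v :: "'i \<Rightarrow> 'a::euclidean_space"
  assumes I: "finite I" and h[measurable]: "h \<in> borel_measurable (\<Pi>\<^sub>M i\<in>I. borel)"
  shows "(\<integral>\<^sup>+e. h (\<lambda>i\<in>I. v i + e i) \<partial>(\<Pi>\<^sub>M i\<in>I. lborel)) = (\<integral>\<^sup>+z. h z \<partial>(\<Pi>\<^sub>M i\<in>I. lborel))"
proof -
  interpret L: product_sigma_finite "\<lambda>_::'i. lborel :: 'a measure" ..
  let ?L = "\<Pi>\<^sub>M i\<in>I. (lborel :: 'a measure)"
  let ?T = "\<lambda>e. \<lambda>i\<in>I. v i + e i"
  have T[measurable]: "?T \<in> ?L \<rightarrow>\<^sub>M (\<Pi>\<^sub>M i\<in>I. borel)" by measurable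
  have "distr ?L (\<Pi>\<^sub>M i\<in>I. borel) ?T = ?L"
  proof (rule L.PiM_eqI[OF I])
    fix A :: "'i \<Rightarrow> 'a set" assume "\<And>i. i \<in> I \<Longrightarrow> A i \<in> sets lborel"
    then have A[measurable]: "\<And>i. i \<in> I \<Longrightarrow> A i \<in> sets borel" by simp
    have pre: "(\<lambda>x. v i + x) -` A i \<in> sets borel" if "i \<in> I" for i
      using measurable_sets[of "\<lambda>x. v i + x" borel borel "A i"] A that by simp
    have "emeasure (distr ?L (\<Pi>\<^sub>M i\<in>I. borel) ?T) (Pi\<^sub>E I A) = emeasure ?L (?T -` Pi\<^sub>E I A \<inter> space ?L)"
      using I A by (intro emeasure_distr sets_PiM_I_finite T)
    also have "?T -` Pi\<^sub>E I A \<inter> space ?L = Pi\<^sub>E I (\<lambda>i. (\<lambda>x. v i + x) -` A i)"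
      by (auto simp: space_PiM PiE_iff)
    also have "emeasure ?L \<dots> = (\<Prod>i\<in>I. emeasure lborel ((\<lambda>x. v i + x) -` A i))"
      using pre by (intro L.emeasure_PiM I) auto
    also have "\<dots> = (\<Prod>i\<in>I. emeasure lborel (A i))"
    proof (rule prod.cong)
      fix i assume "i \<in> I"
      then have "emeasure (distr lborel borel (\<lambda>x. v i + x)) (A i) = emeasure lborel ((\<lambda>x. v i + x) -` A i)"
        using A by (subst emeasure_distr) auto
      then show "emeasure lborel ((\<lambda>x. v i + x) -` A i) = emeasure lborel (A i)"
        by (simp add: lborel_distr_plus)
    qed simp
    finally show "emeasure (distr ?L (\<Pi>\<^sub>M i\<in>I. borel) ?T) (Pi\<^sub>E I A) = (\<Prod>i\<in>I. emeasure lborel (A i))" .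
  qed (simp add: sets_PiM_lborel)
  then show ?thesis
    using nn_integral_distr[OF T, of h] by (simp cong: measurable_cong_sets add: sets_PiM_lborel)
qed

lemma indep_rvs_distr_pair:
  assumes M: "prob_space M" and indep: "indep_rvs M L X N E"
  shows "distr M (L \<Otimes>\<^sub>M N) (\<lambda>\<omega>. (X \<omega>, E \<omega>)) = distr M L X \<Otimes>\<^sub>M distr M N E"
proof -
  interpret prob_space M by fact
  have X[measurable]: "X \<in> M \<rightarrow>\<^sub>M L" and E[measurable]: "E \<in> M \<rightarrow>\<^sub>M N"
    using indep by (auto simp: indep_rvs_def)
  interpret DX: prob_space "distr M L X" by (rule prob_space_distr) fact
  interpret DE: prob_space "distr M N E" by (rule prob_space_distr) fact
  show ?thesis
  proof (rule pair_measure_eqI[symmetric])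
    show "sigma_finite_measure (distr M L X)" "sigma_finite_measure (distr M N E)" by unfold_locales
    fix A B assume "A \<in> sets (distr M L X)" "B \<in> sets (distr M N E)"
    then have A[measurable]: "A \<in> sets L" and B[measurable]: "B \<in> sets N" by auto
    have "prob ((X -` A \<inter> space M) \<inter> (E -` B \<inter> space M)) = prob (X -` A \<inter> space M) * prob (E -` B \<inter> space M)"
      using indep A B by (intro indep_setD) (auto simp: indep_rvs_def)
    moreover have "(\<lambda>\<omega>. (X \<omega>, E \<omega>)) -` (A \<times> B) \<inter> space M = (X -` A \<inter> space M) \<inter> (E -` B \<inter> space M)" by auto
    ultimately show "emeasure (distr M L X) A * emeasure (distr M N E) B
        = emeasure (distr M (L \<Otimes>\<^sub>M N) (\<lambda>\<omega>. (X \<omega>, E \<omega>))) (A \<times> B)"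
      by (simp add: emeasure_distr emeasure_eq_measure ennreal_mult)
  qed simp
qed

lemma mvn_density_gauss_kernel:
  "mvn_density m K x = gauss_kernel (matrix_inv K) (x - m) / sqrt ((2 * pi) ^ CARD('n) * det K)"
  for K :: "real^'n^'n"
  by (simp add: mvn_density_def gauss_kernel_def)

lemma mvn_distributedD:
  assumes "mvn_distributed M X m K"
  shows "X \<in> borel_measurable M" "distr M borel X = density lborel (\<lambda>x. ennreal (mvn_density m K x))"
proof -
  have *: "X \<in> M \<rightarrow>\<^sub>M lborel" "distr M lborel X = density lborel (\<lambda>x. ennreal (mvn_density m K x))"
    using assms unfolding mvn_distributed_def distributed_def by blast+
  then show "X \<in> borel_measurable M" by simp
  have "distr M borel X = distr M lborel X" by (rule distr_cong) auto
  with * show "distr M borel X = density lborel (\<lambda>x. ennreal (mvn_density m K x))" by simp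
qed

text \<open>In HOL the square root of a nonpositive number is nonpositive and division by 0 gives 0.
  Otherwise, therefore, \<open>mvn_density\<close> would be nowhere positive and \<open>X\<close>
  would have a law of mass 0.\<close>

lemma mvn_distributed_normalizer_pos:
  fixes K :: "real^'n^'n"
  assumes M: "prob_space M" and X: "mvn_distributed M X m K"
  shows "0 < sqrt ((2 * pi) ^ CARD('n) * det K)"
proof (rule ccontr)
  assume "\<not> ?thesis"
  then have "ennreal (mvn_density m K x) = 0" for x
    unfolding mvn_density_gauss_kernel using less_imp_le[OF gauss_kernel_pos[of "matrix_inv K" "x - m"]]
    by (intro ennreal_neg divide_nonneg_nonpos) auto
  then have "distr M borel X = density lborel (\<lambda>_. 0)"
    using mvn_distributedD(2)[OF X] by simp
  moreover have "emeasure (distr M borel X) (space (distr M borel X)) = 1"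
    by (intro prob_space.emeasure_space_1 prob_space.prob_space_distr M mvn_distributedD(1)[OF X])
  ultimately show False
    by (simp add: emeasure_density)
qed

text \<open>Keeps the simplifier from rewriting the index set \<open>{1..k}\<close> to \<open>{Suc 0..k}\<close>.\<close>
declare One_nat_def[simp del]

section \<open>Completing the square in the joint exponent\<close>

lemma quadratic_form_diff:
  assumes "sym_pos_def S"
  shows "(x - y) \<bullet> (S *v (x - y)) = x \<bullet> (S *v x) - 2 * (x \<bullet> (S *v y)) + y \<bullet> (S *v y)"
  using sym_pos_def_self_adjoint[OF assms, of y x]
  by (simp add: matrix_vector_mult_diff_distrib inner_diff_left inner_diff_right inner_commute)

definition post_precision :: "nat \<Rightarrow> real^'n^'n \<Rightarrow> real^'p^'p \<Rightarrow> real^'n^'p \<Rightarrow> real^'n^'n" where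
  "post_precision k K0 R H = matrix_inv K0 + real k *\<^sub>R (transpose H ** matrix_inv R ** H)"

text \<open>Defined for an arbitrary family \<open>z\<close>, since a regular conditional
  distribution must be given at all observation vectors. The data enter only through their
  sum.\<close>

definition post_mean ::
    "nat \<Rightarrow> real^'n \<Rightarrow> real^'n^'n \<Rightarrow> real^'p^'p \<Rightarrow> real^'n^'p \<Rightarrow> (nat \<Rightarrow> real^'p) \<Rightarrow> real^'n" where
  "post_mean k m0 K0 R H z = matrix_inv (post_precision k K0 R H) *v
     (matrix_inv K0 *v m0 + (transpose H ** matrix_inv R) *v (\<Sum>i\<in>{1..k}. z i))"

text \<open>What remains of the joint quadratic form once the square in the signal is
  completed.\<close>

definition post_residual ::
    "nat \<Rightarrow> real^'n \<Rightarrow> real^'n^'n \<Rightarrow> real^'p^'p \<Rightarrow> real^'n^'p \<Rightarrow> (nat \<Rightarrow> real^'p) \<Rightarrow> real" where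
  "post_residual k m0 K0 R H z = m0 \<bullet> (matrix_inv K0 *v m0) + (\<Sum>i\<in>{1..k}. z i \<bullet> (matrix_inv R *v z i))
     - post_mean k m0 K0 R H z \<bullet> (post_precision k K0 R H *v post_mean k m0 K0 R H z)"

lemma sym_pos_def_post_precision:
  "sym_pos_def K0 \<Longrightarrow> sym_pos_def R \<Longrightarrow> sym_pos_def (post_precision k K0 R H)"
  unfolding post_precision_def by (intro sym_pos_def_posterior_precision sym_pos_def_matrix_inv) auto

lemma gauss_kernel_complete_square:
  fixes H :: "real^'n^'p"
  assumes K0: "sym_pos_def K0" and R: "sym_pos_def R"
  shows "gauss_kernel (matrix_inv K0) (x - m0) * (\<Prod>i\<in>{1..k}. gauss_kernel (matrix_inv R) (z i - H *v x))
    = exp (- (1/2) * post_residual k m0 K0 R H z) * gauss_kernel (post_precision k K0 R H) (x - post_mean k m0 K0 R H z)"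
proof -
  let ?S = "matrix_inv R" and ?m = "post_mean k m0 K0 R H z" and ?P = "post_precision k K0 R H"
  have S: "sym_pos_def ?S" and P: "sym_pos_def ?P"
    using K0 R by (simp_all add: sym_pos_def_matrix_inv sym_pos_def_post_precision)
  \<comment> \<open>Moving \<open>H\<close> across as its transpose turns each likelihood exponent
    into a quadratic polynomial on the signal space.\<close>
  have lik: "(z i - H *v x) \<bullet> (?S *v (z i - H *v x))
      = z i \<bullet> (?S *v z i) - 2 * (x \<bullet> ((transpose H ** ?S) *v z i)) + x \<bullet> ((transpose H ** ?S ** H) *v x)" for i
  proof -
    have "x \<bullet> ((transpose H ** ?S) *v y) = (H *v x) \<bullet> (?S *v y)" for y
      by (metis inner_matrix_vector_transpose matrix_vector_mul_assoc transpose_transpose)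
    moreover from this[of "H *v x"] have "x \<bullet> ((transpose H ** ?S ** H) *v x) = (H *v x) \<bullet> (?S *v (H *v x))"
      by (simp only: matrix_vector_mul_assoc matrix_mul_assoc)
    moreover have "z i \<bullet> (?S *v (H *v x)) = (H *v x) \<bullet> (?S *v z i)"
      using sym_pos_def_self_adjoint[OF S, of "z i" "H *v x"] by (simp add: inner_commute)
    ultimately show ?thesis by (simp add: quadratic_form_diff[OF S])
  qed
  have "(\<Sum>i\<in>{1..k}. (z i - H *v x) \<bullet> (?S *v (z i - H *v x)))
      = (\<Sum>i\<in>{1..k}. z i \<bullet> (?S *v z i)) - 2 * (x \<bullet> ((transpose H ** ?S) *v (\<Sum>i\<in>{1..k}. z i)))
        + real k * (x \<bullet> ((transpose H ** ?S ** H) *v x))"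
    unfolding lik sum.distrib sum_subtractf
    by (simp add: sum_distrib_left[symmetric] inner_sum_right[symmetric] vec.sum[symmetric])
  moreover have "(x - ?m) \<bullet> (?P *v (x - ?m)) = x \<bullet> (matrix_inv K0 *v x) + real k * (x \<bullet> ((transpose H ** ?S ** H) *v x))
      - 2 * (x \<bullet> (matrix_inv K0 *v m0)) - 2 * (x \<bullet> ((transpose H ** ?S) *v (\<Sum>i\<in>{1..k}. z i))) + ?m \<bullet> (?P *v ?m)"
  proof -
    \<comment> \<open>The normal equation for the centre: it makes the linear term of the completed
      square equal to that of prior plus likelihood.\<close>
    have "?P *v ?m = matrix_inv K0 *v m0 + (transpose H ** ?S) *v (\<Sum>i\<in>{1..k}. z i)"
      unfolding post_mean_def by (rule sym_pos_def_matrix_inv_cancel[OF P])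
    moreover have "x \<bullet> (?P *v x) = x \<bullet> (matrix_inv K0 *v x) + real k * (x \<bullet> ((transpose H ** ?S ** H) *v x))"
      by (simp add: post_precision_def matrix_vector_mult_add_rdistrib inner_add_right flip: scaleR_matrix_vector_assoc)
    ultimately show ?thesis
      by (simp add: quadratic_form_diff[OF P] inner_add_right)
  qed
  ultimately have eq: "(x - m0) \<bullet> (matrix_inv K0 *v (x - m0)) + (\<Sum>i\<in>{1..k}. (z i - H *v x) \<bullet> (?S *v (z i - H *v x)))
      = post_residual k m0 K0 R H z + (x - ?m) \<bullet> (?P *v (x - ?m))"
    by (simp add: quadratic_form_diff[OF sym_pos_def_matrix_inv[OF K0]] post_residual_def)
  have "(\<Prod>i\<in>{1..k}. gauss_kernel ?S (z i - H *v x))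
      = exp (- (1/2) * (\<Sum>i\<in>{1..k}. (z i - H *v x) \<bullet> (?S *v (z i - H *v x))))"
    unfolding gauss_kernel_def sum_distrib_left by (rule exp_sum[symmetric]) simp
  then show ?thesis
    by (simp only: gauss_kernel_def mult_exp_exp distrib_left[symmetric] eq)
qed

text \<open>The marginal density of the observations; the integral over the signal is kept as
  \<open>gauss_mass\<close>.\<close>

definition evidence ::
    "nat \<Rightarrow> real^'n \<Rightarrow> real^'n^'n \<Rightarrow> real^'p^'p \<Rightarrow> real^'n^'p \<Rightarrow> (nat \<Rightarrow> real^'p) \<Rightarrow> real" where
  "evidence k m0 K0 R H z = exp (- (1/2) * post_residual k m0 K0 R H z) * gauss_mass (post_precision k K0 R H)
     / (sqrt ((2 * pi) ^ CARD('n) * det K0) * sqrt ((2 * pi) ^ CARD('p) * det R) ^ k)"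

lemma measurable_post_mean[measurable]:
  "post_mean k m0 K0 R H \<in> borel_measurable (\<Pi>\<^sub>M i\<in>{1..k}. borel)"
  unfolding post_mean_def by measurable

lemma measurable_evidence[measurable]:
  "evidence k m0 K0 R H \<in> borel_measurable (\<Pi>\<^sub>M i\<in>{1..k}. borel)"
  unfolding evidence_def post_residual_def by measurable

lemma measurable_mvn_density[measurable]: "mvn_density m K \<in> borel_measurable borel"
  unfolding mvn_density_gauss_kernel[abs_def] by measurable

section \<open>Joint law of signal and observations\<close>

lemma linear_gaussian_modelD:
  assumes "linear_gaussian_model k m0 K0 R M f \<epsilon>"
  shows "prob_space M" "mvn_distributed M f m0 K0"
    "\<And>i. i \<in> {1..k} \<Longrightarrow> mvn_distributed M (\<epsilon> i) 0 R"
    "prob_space.indep_vars M (\<lambda>_. borel) \<epsilon> {1..k}"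
    "indep_rvs M borel f (\<Pi>\<^sub>M i\<in>{1..k}. borel) (\<lambda>\<omega>. \<lambda>i\<in>{1..k}. \<epsilon> i \<omega>)"
  using assms unfolding linear_gaussian_model_def by blast+

lemma linear_gaussian_model_normalizer_pos:
  fixes K0 :: "real^'n^'n" and R :: "real^'p^'p"
  assumes k: "k \<ge> 1" and model: "linear_gaussian_model k m0 K0 R M f \<epsilon>"
  shows "0 < sqrt ((2 * pi) ^ CARD('n) * det K0)" "0 < sqrt ((2 * pi) ^ CARD('p) * det R)"
proof -
  note D = linear_gaussian_modelD[OF model]
  show "0 < sqrt ((2 * pi) ^ CARD('n) * det K0)"
    by (rule mvn_distributed_normalizer_pos[OF D(1,2)])
  show "0 < sqrt ((2 * pi) ^ CARD('p) * det R)"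
    using k by (intro mvn_distributed_normalizer_pos[OF D(1) D(3)[of 1]]) simp
qed

lemma evidence_pos:
  assumes K0: "sym_pos_def K0" and R: "sym_pos_def R" and k: "k \<ge> 1"
    and model: "linear_gaussian_model k m0 K0 R M f \<epsilon>"
  shows "0 < evidence k m0 K0 R H z"
proof -
  note c = linear_gaussian_model_normalizer_pos[OF k model]
  have "0 < gauss_mass (post_precision k K0 R H)"
    by (rule gauss_mass_pos[OF sym_pos_def_post_precision[OF K0 R]])
  then show ?thesis
    unfolding evidence_def
    by (rule divide_pos_pos[OF mult_pos_pos[OF exp_gt_zero] mult_pos_pos[OF c(1) zero_less_power[OF c(2)]]])
qed

text \<open>On the product of the laws of signal and noise, the noise is replaced by
  \<open>z i - H *v x\<close> at fixed \<open>x\<close>. Tonelli then moves the observations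
  outside, and the inner integral is evidence times posterior probability.\<close>

lemma linear_gaussian_model_joint:
  fixes H :: "real^'n^'p"
  assumes K0: "sym_pos_def K0" and R: "sym_pos_def R" and k: "k \<ge> 1"
    and model: "linear_gaussian_model k m0 K0 R M f \<epsilon>"
    and A[measurable]: "A \<in> sets borel" and B[measurable]: "B \<in> sets (\<Pi>\<^sub>M i\<in>{1..k}. borel)"
  shows "emeasure M {\<omega>\<in>space M. f \<omega> \<in> A \<and> observations k H f \<epsilon> \<omega> \<in> B}
    = (\<integral>\<^sup>+z. ennreal (evidence k m0 K0 R H z) *
        (emeasure (gauss_shift (post_mean k m0 K0 R H z) (post_precision k K0 R H)) A * indicator B z)
        \<partial>(\<Pi>\<^sub>M i\<in>{1..k}. lborel))"
proof -
  let ?I = "{1..k}" and ?P = "post_precision k K0 R H"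
  let ?N = "\<Pi>\<^sub>M i\<in>?I. (borel :: (real^'p) measure)" and ?L = "\<Pi>\<^sub>M i\<in>?I. (lborel :: (real^'p) measure)"
  let ?E = "\<lambda>\<omega>. \<lambda>i\<in>?I. \<epsilon> i \<omega>"
  let ?p = "\<lambda>x. ennreal (mvn_density m0 K0 x)" and ?r = "\<lambda>x. ennreal (mvn_density 0 R x)"
  note model_facts = linear_gaussian_modelD[OF model]
  interpret M: prob_space M by (rule model_facts(1))
  interpret L: product_sigma_finite "\<lambda>_::nat. lborel :: (real^'p) measure" ..
  interpret L: sigma_finite_measure ?L by (rule L.sigma_finite) simp
  interpret LL: pair_sigma_finite lborel ?L ..
  have P: "sym_pos_def ?P" using K0 R by (rule sym_pos_def_post_precision)
  have indep: "indep_rvs M borel f ?N ?E"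
    by (rule model_facts(5))
  then have f[measurable]: "f \<in> borel_measurable M" and E[measurable]: "?E \<in> M \<rightarrow>\<^sub>M ?N"
    by (simp_all add: indep_rvs_def)
  note distr_f = mvn_distributedD(2)[OF model_facts(2)] and distr_\<epsilon> = mvn_distributedD[OF model_facts(3)]
  have distr_E: "distr M ?N ?E = density ?L (\<lambda>e. \<Prod>i\<in>?I. ?r (e i))"
  proof -
    have "distr M ?N ?E = (\<Pi>\<^sub>M i\<in>?I. distr M borel (\<epsilon> i))"
    proof (rule M.indep_vars_iff_distr_eq_PiM'[THEN iffD1])
      \<comment> \<open>The characterisation of independence by a product law is stated for a
        nonempty index set.\<close>
      show "?I \<noteq> {}" using k by simp
      show "M.indep_vars (\<lambda>_. borel) \<epsilon> ?I" by (rule model_facts(4))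
    qed (rule distr_\<epsilon>(1))
    also have "\<dots> = (\<Pi>\<^sub>M i\<in>?I. density lborel ?r)"
      by (intro PiM_cong distr_\<epsilon>(2)) auto
    also have "\<dots> = density ?L (\<lambda>e. \<Prod>i\<in>?I. ?r (e i))"
    proof (rule density_PiM_lborel)
      have "prob_space (density lborel ?r)"
        using M.prob_space_distr[OF distr_\<epsilon>(1)[of 1]] distr_\<epsilon>(2)[of 1] k by simp
      then show "sigma_finite_measure (density lborel ?r)"
        by (simp add: prob_space_imp_sigma_finite)
    qed simp_all
    finally show ?thesis .
  qed
  interpret DE: prob_space "distr M ?N ?E" by (rule M.prob_space_distr) fact
  let ?g = "\<lambda>(x, e). indicator A x * indicator B (\<lambda>i\<in>?I. H *v x + e i) :: ennreal"
  have [measurable]: "(\<lambda>p. \<lambda>i\<in>?I. H *v fst p + snd p i) \<in> borel \<Otimes>\<^sub>M ?N \<rightarrow>\<^sub>M ?N"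
    by measurable
  have g[measurable]: "?g \<in> borel_measurable (borel \<Otimes>\<^sub>M ?N)"
    unfolding split_beta' by measurable
  have obs: "observations k H f \<epsilon> \<omega> = (\<lambda>i\<in>?I. H *v f \<omega> + ?E \<omega> i)" for \<omega>
    by (auto simp: observations_def fun_eq_iff)
  have [measurable]: "(\<lambda>\<omega>. \<lambda>i\<in>?I. H *v f \<omega> + ?E \<omega> i) \<in> M \<rightarrow>\<^sub>M ?N"
    using measurable_compose[OF measurable_Pair[OF f E], of "\<lambda>p. \<lambda>i\<in>?I. H *v fst p + snd p i" ?N] by simp
  have "emeasure M {\<omega>\<in>space M. f \<omega> \<in> A \<and> observations k H f \<epsilon> \<omega> \<in> B}
      = (\<integral>\<^sup>+\<omega>. indicator {\<omega>\<in>space M. f \<omega> \<in> A \<and> observations k H f \<epsilon> \<omega> \<in> B} \<omega> \<partial>M)"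
    unfolding obs by (subst nn_integral_indicator) measurable
  also have "\<dots> = (\<integral>\<^sup>+\<omega>. ?g (f \<omega>, ?E \<omega>) \<partial>M)"
    unfolding obs by (intro nn_integral_cong) (auto simp: indicator_def)
  also have "\<dots> = (\<integral>\<^sup>+p. ?g p \<partial>(distr M borel f \<Otimes>\<^sub>M distr M ?N ?E))"
    unfolding indep_rvs_distr_pair[OF M.prob_space_axioms indep, symmetric]
    by (rule nn_integral_distr[OF measurable_Pair[OF f E], symmetric]) (subst measurable_distr_eq1, rule g)
  also have "\<dots> = (\<integral>\<^sup>+x. \<integral>\<^sup>+e. ?g (x, e) \<partial>distr M ?N ?E \<partial>distr M borel f)"
    by (rule DE.nn_integral_fst[symmetric]) (simp cong: measurable_cong_sets add: g)
  also have "\<dots> = (\<integral>\<^sup>+x. ?p x * (\<integral>\<^sup>+e. (\<Prod>i\<in>?I. ?r (e i)) * ?g (x, e) \<partial>?L) \<partial>lborel)"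
  proof -
    have q: "(\<lambda>e. \<Prod>i\<in>?I. ?r (e i)) \<in> borel_measurable ?L" by measurable
    have inner: "(\<integral>\<^sup>+e. ?g (x, e) \<partial>distr M ?N ?E) = (\<integral>\<^sup>+e. (\<Prod>i\<in>?I. ?r (e i)) * ?g (x, e) \<partial>?L)" for x
      unfolding distr_E using measurable_compose[OF measurable_Pair1' g, of x]
      by (intro nn_integral_density q) (simp_all cong: measurable_cong_sets add: sets_PiM_lborel)
    show ?thesis
      unfolding distr_f inner
    proof (rule nn_integral_density)
      have "(\<lambda>p. (\<Prod>i\<in>?I. ?r (snd p i)) * ?g p) \<in> borel_measurable (borel \<Otimes>\<^sub>M ?N)" by measurable
      then show "(\<lambda>x. \<integral>\<^sup>+e. (\<Prod>i\<in>?I. ?r (e i)) * ?g (x, e) \<partial>?L) \<in> borel_measurable lborel"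
        by (intro L.borel_measurable_nn_integral) (simp add: split_beta' cong: measurable_cong_sets)
    qed measurable
  qed
  also have "\<dots> = (\<integral>\<^sup>+x. \<integral>\<^sup>+z. ?p x * ((\<Prod>i\<in>?I. ?r (z i - H *v x)) * (indicator A x * indicator B z)) \<partial>?L \<partial>lborel)"
  proof (rule nn_integral_cong)
    fix x
    let ?h = "\<lambda>z. (\<Prod>i\<in>?I. ?r (z i - H *v x)) * (indicator A x * indicator B z)"
    have [measurable]: "?h \<in> borel_measurable ?N" by measurable
    have "(\<integral>\<^sup>+e. (\<Prod>i\<in>?I. ?r (e i)) * ?g (x, e) \<partial>?L) = (\<integral>\<^sup>+e. ?h (\<lambda>i\<in>?I. H *v x + e i) \<partial>?L)"
      by (intro nn_integral_cong) (auto intro!: arg_cong2[where f="(*)"] prod.cong)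
    also have "\<dots> = (\<integral>\<^sup>+z. ?h z \<partial>?L)"
      by (rule nn_integral_PiM_lborel_shift) simp_all
    finally show "?p x * (\<integral>\<^sup>+e. (\<Prod>i\<in>?I. ?r (e i)) * ?g (x, e) \<partial>?L) = (\<integral>\<^sup>+z. ?p x * ?h z \<partial>?L)"
      by (simp add: nn_integral_cmult cong: measurable_cong_sets)
  qed
  also have "\<dots> = (\<integral>\<^sup>+z. \<integral>\<^sup>+x. ?p x * ((\<Prod>i\<in>?I. ?r (z i - H *v x)) * (indicator A x * indicator B z)) \<partial>lborel \<partial>?L)"
    by (rule LL.Fubini'[symmetric]) measurable
  also have "\<dots> = (\<integral>\<^sup>+z. ennreal (evidence k m0 K0 R H z) *
        (emeasure (gauss_shift (post_mean k m0 K0 R H z) ?P) A * indicator B z) \<partial>?L)"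
  proof (rule nn_integral_cong)
    fix z
    let ?c0 = "sqrt ((2 * pi) ^ CARD('n) * det K0)" and ?c1 = "sqrt ((2 * pi) ^ CARD('p) * det R)"
    let ?m = "post_mean k m0 K0 R H z" and ?e = "evidence k m0 K0 R H z"
    note c0 = linear_gaussian_model_normalizer_pos(1)[OF k model] and c1 = linear_gaussian_model_normalizer_pos(2)[OF k model]
    have e: "0 \<le> ?e"
      using evidence_pos[OF K0 R k model] by (rule less_imp_le)
    \<comment> \<open>Bayes' rule pointwise: the factor \<open>gauss_mass ?P\<close> inside
      \<open>evidence\<close> cancels against the normaliser of the posterior.\<close>
    have dens: "?p x * (\<Prod>i\<in>?I. ?r (z i - H *v x)) = ennreal ?e * ennreal (gauss_kernel ?P (x - ?m) / gauss_mass ?P)" for x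
    proof -
      have "?p x * (\<Prod>i\<in>?I. ?r (z i - H *v x)) = ennreal (mvn_density m0 K0 x * (\<Prod>i\<in>?I. mvn_density 0 R (z i - H *v x)))"
      proof -
        have "0 \<le> mvn_density m0 K0 x"
          unfolding mvn_density_gauss_kernel by (rule divide_nonneg_pos[OF less_imp_le[OF gauss_kernel_pos] c0])
        moreover have "0 \<le> mvn_density 0 R v" for v
          unfolding mvn_density_gauss_kernel by (rule divide_nonneg_pos[OF less_imp_le[OF gauss_kernel_pos] c1])
        ultimately show ?thesis by (simp add: prod_ennreal ennreal_mult prod_nonneg)
      qed
      also have "mvn_density m0 K0 x * (\<Prod>i\<in>?I. mvn_density 0 R (z i - H *v x))
          = gauss_kernel (matrix_inv K0) (x - m0) * (\<Prod>i\<in>?I. gauss_kernel (matrix_inv R) (z i - H *v x)) / (?c0 * ?c1 ^ k)"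
        by (simp add: mvn_density_gauss_kernel prod_dividef)
      also have "\<dots> = ?e * (gauss_kernel ?P (x - ?m) / gauss_mass ?P)"
        using gauss_mass_pos[OF P] unfolding gauss_kernel_complete_square[OF K0 R] evidence_def by simp
      also have "ennreal \<dots> = ennreal ?e * ennreal (gauss_kernel ?P (x - ?m) / gauss_mass ?P)"
        by (rule ennreal_mult'[OF e])
      finally show ?thesis .
    qed
    have "(\<integral>\<^sup>+x. ?p x * ((\<Prod>i\<in>?I. ?r (z i - H *v x)) * (indicator A x * indicator B z)) \<partial>lborel)
        = (\<integral>\<^sup>+x. ennreal ?e * indicator B z * (ennreal (gauss_kernel ?P (x - ?m) / gauss_mass ?P) * indicator A x) \<partial>lborel)"
      by (intro nn_integral_cong) (simp only: mult.assoc[symmetric] dens, simp only: mult_ac)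
    also have "\<dots> = ennreal ?e * indicator B z * emeasure (gauss_shift ?m ?P) A"
      by (subst nn_integral_cmult) (simp_all add: emeasure_gauss_shift[OF P])
    finally show "(\<integral>\<^sup>+x. ?p x * ((\<Prod>i\<in>?I. ?r (z i - H *v x)) * (indicator A x * indicator B z)) \<partial>lborel)
        = ennreal ?e * (emeasure (gauss_shift ?m ?P) A * indicator B z)"
      by (simp only: mult_ac)
  qed
  finally show ?thesis .
qed


lemma measurable_observations:
  assumes "linear_gaussian_model k m0 K0 R M f \<epsilon>"
  shows "observations k H f \<epsilon> \<in> M \<rightarrow>\<^sub>M (\<Pi>\<^sub>M i\<in>{1..k}. borel)"
proof -
  note model_facts = linear_gaussian_modelD[OF assms]
  note [measurable] = mvn_distributedD(1)[OF model_facts(2)] mvn_distributedD(1)[OF model_facts(3)]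
  show ?thesis
    unfolding observations_def by (intro measurable_restrict) measurable
qed

text \<open>The joint formula with \<open>A = UNIV\<close>, where the posterior kernel has mass
  1.\<close>

lemma distr_observations:
  fixes H :: "real^'n^'p"
  assumes K0: "sym_pos_def K0" and R: "sym_pos_def R" and k: "k \<ge> 1"
    and model: "linear_gaussian_model k m0 K0 R M f \<epsilon>"
  shows "distr M (\<Pi>\<^sub>M i\<in>{1..k}. borel) (observations k H f \<epsilon>)
    = density (\<Pi>\<^sub>M i\<in>{1..k}. lborel) (\<lambda>z. ennreal (evidence k m0 K0 R H z))" (is "?D = ?E")
proof (rule measure_eqI)
  show "sets ?D = sets ?E" by (simp add: sets_PiM_lborel)
  fix B assume "B \<in> sets ?D"
  then have B: "B \<in> sets (\<Pi>\<^sub>M i\<in>{1..k}. borel)" by simp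
  have "emeasure (gauss_shift m (post_precision k K0 R H)) UNIV = 1" for m
    using prob_space.emeasure_space_1[OF prob_space_gauss_shift[OF sym_pos_def_post_precision[OF K0 R, of k H], of m]]
    by (simp add: gauss_shift_def)
  then have "emeasure M {\<omega>\<in>space M. observations k H f \<epsilon> \<omega> \<in> B} = emeasure ?E B"
    using linear_gaussian_model_joint[OF K0 R k model _ B, of UNIV H] B
    by (subst emeasure_density) (simp_all add: sets_PiM_lborel cong: measurable_cong_sets)
  then show "emeasure ?D B = emeasure ?E B"
    using B by (subst emeasure_distr[OF measurable_observations[OF model]]) (simp_all add: vimage_def Int_def conj_commute)
qed

lemma regular_conditional_distribution_gauss_shift:
  fixes H :: "real^'n^'p"
  assumes K0: "sym_pos_def K0" and R: "sym_pos_def R" and k: "k \<ge> 1"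
    and model: "linear_gaussian_model k m0 K0 R M f \<epsilon>"
  shows "regular_conditional_distribution M f borel (observations k H f \<epsilon>) (\<Pi>\<^sub>M i\<in>{1..k}. borel)
    (\<lambda>z. gauss_shift (post_mean k m0 K0 R H z) (post_precision k K0 R H))"
proof -
  let ?N = "\<Pi>\<^sub>M i\<in>{1..k}. (borel :: (real^'p) measure)" and ?L = "\<Pi>\<^sub>M i\<in>{1..k}. (lborel :: (real^'p) measure)"
  let ?P = "post_precision k K0 R H" and ?m = "post_mean k m0 K0 R H"
  have "gauss_measure ?P \<in> space (prob_algebra borel)"
    using prob_space_gauss_measure[OF sym_pos_def_post_precision[OF K0 R]] by (simp add: space_prob_algebra)
  then have kernel: "(\<lambda>z. gauss_shift (?m z) ?P) \<in> ?N \<rightarrow>\<^sub>M prob_algebra borel"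
    unfolding gauss_shift_def by (intro measurable_distr_prob_space2[where M=borel] measurable_const) measurable
  have "emeasure M {\<omega>\<in>space M. f \<omega> \<in> A \<and> observations k H f \<epsilon> \<omega> \<in> B}
      = (\<integral>\<^sup>+z. emeasure (gauss_shift (?m z) ?P) A * indicator B z \<partial>distr M ?N (observations k H f \<epsilon>))"
    if A: "A \<in> sets borel" and B: "B \<in> sets ?N" for A B
    unfolding linear_gaussian_model_joint[OF K0 R k model A B] distr_observations[OF K0 R k model]
  proof (rule nn_integral_density[symmetric])
    note [measurable] = B measurable_emeasure_kernel[OF measurable_prob_algebraD[OF kernel] A]
    show "(\<lambda>z. ennreal (evidence k m0 K0 R H z)) \<in> borel_measurable ?L" by measurable
    show "(\<lambda>z. emeasure (gauss_shift (?m z) ?P) A * indicator B z) \<in> borel_measurable ?L" by measurable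
  qed
  with kernel show ?thesis by (simp add: regular_conditional_distribution_def)
qed

text \<open>The precision does not depend on \<open>z\<close>, and the centre is affine in finitely
  many coordinates, hence continuous for the product topology.\<close>

lemma weakly_continuous_on_gauss_shift:
  assumes "sym_pos_def (post_precision k K0 R H)"
  shows "weakly_continuous_on S (\<lambda>z. gauss_shift (post_mean k m0 K0 R H z) (post_precision k K0 R H))"
  unfolding weakly_continuous_on_def
proof (intro allI impI continuous_on_gauss_shift assms)
  have coord: "continuous_on S (\<lambda>z. z i)" for i :: nat
    by (rule continuous_on_subset[OF continuous_on_product_coordinates]) simp
  show "continuous_on S (post_mean k m0 K0 R H)"
    unfolding post_mean_def
    by (intro continuous_on_compose2[OF matrix_vector_mult_linear_continuous_on[of UNIV]]
        continuous_intros coord) auto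
qed auto

section \<open>Support of the observations and identification of the posterior\<close>

lemma emeasure_lborel_open_pos:
  fixes S :: "'a::euclidean_space set"
  assumes "open S" "S \<noteq> {}"
  shows "emeasure lborel S \<noteq> 0"
proof
  assume "emeasure lborel S = 0"
  then have "S \<in> null_sets lborel" using assms by (simp add: null_sets_def)
  then show False
    using open_not_negligible[OF assms] by (simp add: negligible_iff_null_sets null_sets_completionI)
qed

text \<open>The topology is that of all functions on \<open>nat\<close>, whereas the law lives on
  vectors indexed by \<open>{1..k}\<close>. A basic open box around \<open>z\<close> still contains
  a box of positive measure in these coordinates, since elsewhere all points of the space agree with
  \<open>z\<close>.\<close>

lemma observations_support:
  fixes H :: "real^'n^'p"
  assumes K0: "sym_pos_def K0" and R: "sym_pos_def R" and k: "k \<ge> 1"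
    and model: "linear_gaussian_model k m0 K0 R M f \<epsilon>"
    and z: "z \<in> space (\<Pi>\<^sub>M i\<in>{1..k}. borel)" and V: "open V" "z \<in> V"
  shows "\<not> (AE w in distr M (\<Pi>\<^sub>M i\<in>{1..k}. borel) (observations k H f \<epsilon>). w \<notin> V)"
proof
  let ?L = "\<Pi>\<^sub>M i\<in>{1..k}. (lborel :: (real^'p) measure)"
  interpret L: product_sigma_finite "\<lambda>_::nat. lborel :: (real^'p) measure" ..
  assume "AE w in distr M (\<Pi>\<^sub>M i\<in>{1..k}. borel) (observations k H f \<epsilon>). w \<notin> V"
  \<comment> \<open>Because \<open>evidence\<close> is positive everywhere, null sets of the law are
    Lebesgue null.\<close>
  then have AE: "AE w in ?L. w \<notin> V"
    unfolding distr_observations[OF K0 R k model]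
    by (subst (asm) AE_density) (simp_all add: evidence_pos[OF K0 R k model] cong: measurable_cong_sets)
  have "openin (product_topology (\<lambda>i. euclidean) UNIV) V"
    using V(1) by (simp add: open_fun_def)
  from product_topology_open_contains_basis[OF this V(2)]
  obtain X where X: "z \<in> (\<Pi>\<^sub>E i\<in>UNIV. X i)" "\<And>i. open (X i)" "(\<Pi>\<^sub>E i\<in>UNIV. X i) \<subseteq> V"
    by auto
  have sub: "Pi\<^sub>E {1..k} X \<subseteq> V"
  proof
    fix w assume w: "w \<in> Pi\<^sub>E {1..k} X"
    have "w i \<in> X i" for i
    proof (cases "i \<in> {1..k}")
      case False
      then have "w i = z i" using w z by (simp add: space_PiM PiE_def extensional_def)
      with X(1) show ?thesis by auto
    qed (use w in auto)
    with X(3) show "w \<in> V" by auto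
  qed
  have "Pi\<^sub>E {1..k} X \<in> sets ?L"
    using X(2) by (intro sets_PiM_I_finite) auto
  moreover have "AE w in ?L. w \<notin> Pi\<^sub>E {1..k} X"
    using AE by eventually_elim (use sub in auto)
  ultimately have "emeasure ?L (Pi\<^sub>E {1..k} X) = 0"
    by (simp add: AE_iff_null_sets[symmetric] null_setsD1)
  moreover have "emeasure ?L (Pi\<^sub>E {1..k} X) = (\<Prod>i\<in>{1..k}. emeasure lborel (X i))"
    using X(2) by (intro L.emeasure_PiM) auto
  ultimately obtain i where "emeasure lborel (X i) = 0" by auto
  with emeasure_lborel_open_pos[OF X(2)] X(1) show False by fastforce
qed

text \<open>Existence comes from the explicit kernel; the support property forces any other weakly
  continuous version to agree with it at the repeated data. The theorem is thereby reduced to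
  moments of \<open>gauss_shift\<close>.\<close>

lemma repeated_posterior_iff:
  fixes H :: "real^'n^'p"
  assumes K0: "sym_pos_def K0" and R: "sym_pos_def R" and k: "k \<ge> 1"
    and model: "linear_gaussian_model k m0 K0 R M f \<epsilon>"
  shows "repeated_posterior k H y M f \<epsilon> \<mu> \<longleftrightarrow>
    \<mu> = gauss_shift (post_mean k m0 K0 R H (\<lambda>i\<in>{1..k}. y)) (post_precision k K0 R H)"
proof -
  let ?\<kappa> = "\<lambda>z. gauss_shift (post_mean k m0 K0 R H z) (post_precision k K0 R H)"
  have M: "prob_space M" using model by (rule linear_gaussian_modelD)
  have z: "(\<lambda>i\<in>{1..k}. y) \<in> space (\<Pi>\<^sub>M i\<in>{1..k}. borel)" by (simp add: space_PiM)
  note rcd = regular_conditional_distribution_gauss_shift[OF K0 R k model, of H]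
  have cont: "weakly_continuous_on S ?\<kappa>" for S
    by (intro weakly_continuous_on_gauss_shift sym_pos_def_post_precision K0 R)
  show ?thesis
  proof
    assume "repeated_posterior k H y M f \<epsilon> \<mu>"
    then obtain \<kappa> where \<kappa>: "regular_conditional_distribution M f borel (observations k H f \<epsilon>) (\<Pi>\<^sub>M i\<in>{1..k}. borel) \<kappa>"
      "weakly_continuous_on (space (\<Pi>\<^sub>M i\<in>{1..k}. borel)) \<kappa>" "\<mu> = \<kappa> (\<lambda>i\<in>{1..k}. y)"
      by (auto simp: repeated_posterior_def conditional_distribution_at_def)
    show "\<mu> = ?\<kappa> (\<lambda>i\<in>{1..k}. y)"
      unfolding \<kappa>(3)
      by (rule weakly_continuous_conditional_distribution_unique[OF M measurable_observations[OF model] \<kappa>(1,2) rcd cont z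
            observations_support[OF K0 R k model z]])
  next
    assume "\<mu> = ?\<kappa> (\<lambda>i\<in>{1..k}. y)"
    with rcd cont show "repeated_posterior k H y M f \<epsilon> \<mu>"
      unfolding repeated_posterior_def conditional_distribution_at_def by (intro exI[of _ ?\<kappa>]) simp
  qed
qed

section \<open>Repeated data and the limits for \<open>H = I\<close>\<close>

lemma post_mean_const:
  "post_mean k m0 K0 R H (\<lambda>i\<in>{1..k}. y) = matrix_inv (post_precision k K0 R H) *v
     (matrix_inv K0 *v m0 + real k *\<^sub>R ((transpose H ** matrix_inv R) *v y))"
proof -
  have "(\<Sum>i\<in>{1..k}. (\<lambda>i\<in>{1..k}. y) i) = real k *\<^sub>R y"
    by (simp add: sum_constant_scaleR del: sum_constant)
  then show ?thesis
    unfolding post_mean_def by (simp only: matrix_vector_mult_scaleR)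
qed

lemma post_precision_mat_1: "post_precision k K0 R (mat 1) = matrix_inv K0 + real k *\<^sub>R matrix_inv R"
  by (simp add: post_precision_def)

text \<open>The prior precision adds a nonnegative amount and
  \<open>real k *\<^sub>R matrix_inv R\<close> adds at least \<open>k * c\<close>, so the precision
  is coercive with constant \<open>k * c\<close>.\<close>

lemma norm_post_covariance_le:
  assumes K0: "sym_pos_def K0" and R: "sym_pos_def R" and k: "k \<ge> 1"
    and c: "c > 0" "\<And>x. c * (norm x)\<^sup>2 \<le> x \<bullet> (matrix_inv R *v x)"
  shows "norm (matrix_inv (post_precision k K0 R (mat 1)) *v v) \<le> norm v / (real k * c)"
proof (rule norm_matrix_inv_le)
  show "sym_pos_def (post_precision k K0 R (mat 1))" using K0 R by (rule sym_pos_def_post_precision)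
  show "0 < real k * c" using k c by simp
  fix x
  have "real k * (c * (norm x)\<^sup>2) \<le> real k * (x \<bullet> (matrix_inv R *v x))"
    by (intro mult_left_mono c) simp
  moreover have "0 \<le> x \<bullet> (matrix_inv K0 *v x)"
    by (intro sym_pos_def_nonneg sym_pos_def_matrix_inv K0)
  ultimately show "real k * c * (norm x)\<^sup>2 \<le> x \<bullet> (post_precision k K0 R (mat 1) *v x)"
    by (simp add: post_precision_mat_1 matrix_vector_mult_add_rdistrib inner_add_right mult.assoc flip: scaleR_matrix_vector_assoc)
qed

lemma post_covariance_mult_tendsto_0:
  fixes K0 R :: "real^'n^'n"
  assumes K0: "sym_pos_def K0" and R: "sym_pos_def R"
  shows "(\<lambda>k. matrix_inv (post_precision k K0 R (mat 1)) *v v) \<longlonglongrightarrow> 0"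
proof -
  obtain c where c: "c > 0" "\<And>x. c * (norm x)\<^sup>2 \<le> x \<bullet> (matrix_inv R *v x)"
    using sym_pos_def_coercive[OF sym_pos_def_matrix_inv[OF R]] by blast
  show ?thesis
  proof (rule Lim_null_comparison)
    show "\<forall>\<^sub>F k in sequentially. norm (matrix_inv (post_precision k K0 R (mat 1)) *v v) \<le> norm v / c * inverse (real k)"
      using eventually_ge_at_top[of "1::nat"]
    proof eventually_elim
      case (elim k)
      then show ?case using norm_post_covariance_le[OF K0 R elim c, of v] by (simp add: field_simps)
    qed
    show "(\<lambda>k. norm v / c * inverse (real k)) \<longlonglongrightarrow> 0"
      by (intro tendsto_mult_right_zero tendsto_inverse_0_at_top filterlim_real_sequentially)
  qed
qed

text \<open>Column \<open>j\<close> is the image of \<open>axis j 1\<close>, so convergence on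
  vectors gives convergence of every entry.\<close>

lemma post_covariance_tendsto_0:
  fixes K0 R :: "real^'n^'n"
  assumes "sym_pos_def K0" and "sym_pos_def R"
  shows "(\<lambda>k. matrix_inv (post_precision k K0 R (mat 1))) \<longlonglongrightarrow> 0"
proof (intro vec_tendstoI)
  fix i j
  have "(\<lambda>k. (matrix_inv (post_precision k K0 R (mat 1)) *v axis j 1) $ i) \<longlonglongrightarrow> (0 :: real^'n) $ i"
    by (intro tendsto_vec_nth post_covariance_mult_tendsto_0 assms)
  then show "(\<lambda>k. matrix_inv (post_precision k K0 R (mat 1)) $ i $ j) \<longlonglongrightarrow> (0 :: real^'n^'n) $ i $ j"
    by (simp add: matrix_vector_mult_basis column_def)
qed

text \<open>With \<open>H = I\<close> the error \<open>m\<^sub>k - y\<close> equals \<open>K\<^sub>k K\<^sub>0\<^sup>-\<^sup>1 (m\<^sub>0 - y)\<close>.\<close>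
lemma post_mean_tendsto:
  fixes K0 R :: "real^'n^'n"
  assumes K0: "sym_pos_def K0" and R: "sym_pos_def R"
  shows "(\<lambda>k. post_mean k m0 K0 R (mat 1) (\<lambda>i\<in>{1..k}. y)) \<longlonglongrightarrow> y"
proof -
  have "post_mean k m0 K0 R (mat 1) (\<lambda>i\<in>{1..k}. y)
      = matrix_inv (post_precision k K0 R (mat 1)) *v (matrix_inv K0 *v (m0 - y)) + y" for k
  proof -
    let ?P = "post_precision k K0 R (mat 1)"
    have "matrix_inv K0 *v m0 + real k *\<^sub>R (matrix_inv R *v y) = matrix_inv K0 *v (m0 - y) + ?P *v y"
      by (simp add: post_precision_mat_1 matrix_vector_mult_add_rdistrib matrix_vector_mult_diff_distrib
          flip: scaleR_matrix_vector_assoc)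
    moreover have "matrix_inv ?P *v (?P *v y) = y"
      by (intro sym_pos_def_matrix_inv_cancel sym_pos_def_post_precision K0 R)
    ultimately show ?thesis
      unfolding post_mean_const by (simp add: matrix_vector_right_distrib)
  qed
  moreover have "(\<lambda>k. matrix_inv (post_precision k K0 R (mat 1)) *v (matrix_inv K0 *v (m0 - y)) + y) \<longlonglongrightarrow> 0 + y"
    by (intro tendsto_intros post_covariance_mult_tendsto_0 K0 R)
  ultimately show ?thesis by simp
qed

text \<open>The limit part allows a different model for each \<open>k\<close>, because the posterior
  depends only on \<open>m0\<close>, \<open>K0\<close>, \<open>R\<close>, \<open>y\<close> and
  \<open>k\<close>. Integrability and invertibility are asserted so that no default value of the
  integral or of \<open>matrix_inv\<close> is involved.\<close>

theorem proposition1: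
  fixes m0 :: "real^'n" and K0 :: "real^'n^'n"
  assumes "sym_pos_def K0"
  shows
    "(\<forall>(H :: real^'n^'p) (R :: real^'p^'p) (y :: real^'p) (k :: nat)
        (M :: 'w measure) (f :: 'w \<Rightarrow> real^'n) (\<epsilon> :: nat \<Rightarrow> 'w \<Rightarrow> real^'p).
        sym_pos_def R \<and> k \<ge> 1 \<and> linear_gaussian_model k m0 K0 R M f \<epsilon> \<longrightarrow>
        (\<exists>!\<mu>. repeated_posterior k H y M f \<epsilon> \<mu>) \<and>
        (\<forall>\<mu>. repeated_posterior k H y M f \<epsilon> \<mu> \<longrightarrow>
           integrable \<mu> (\<lambda>x. (norm x)\<^sup>2) \<and>
           invertible (matrix_inv K0 + real k *\<^sub>R (transpose H ** matrix_inv R ** H)) \<and>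
           covariance_matrix \<mu> =
             matrix_inv (matrix_inv K0 + real k *\<^sub>R (transpose H ** matrix_inv R ** H)) \<and>
           mean_vector \<mu> =
             covariance_matrix \<mu> *v
               (matrix_inv K0 *v m0 + real k *\<^sub>R ((transpose H ** matrix_inv R) *v y))))
     \<and>
     (\<forall>(R :: real^'n^'n) (y :: real^'n)
        (M :: nat \<Rightarrow> 'w measure) (f :: nat \<Rightarrow> 'w \<Rightarrow> real^'n)
        (\<epsilon> :: nat \<Rightarrow> nat \<Rightarrow> 'w \<Rightarrow> real^'n) (\<mu> :: nat \<Rightarrow> (real^'n) measure).
        sym_pos_def R \<and>
        (\<forall>k\<ge>1. linear_gaussian_model k m0 K0 R (M k) (f k) (\<epsilon> k) \<and>
                repeated_posterior k (mat 1) y (M k) (f k) (\<epsilon> k) (\<mu> k)) \<longrightarrow>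
        (\<forall>k\<ge>1. covariance_matrix (\<mu> k) =
                 matrix_inv (matrix_inv K0 + real k *\<^sub>R matrix_inv R)) \<and>
        (\<lambda>k. covariance_matrix (\<mu> k)) \<longlonglongrightarrow> 0 \<and>
        (\<lambda>k. mean_vector (\<mu> k)) \<longlonglongrightarrow> y)"
proof (intro conjI allI impI; (elim conjE)?)
  note K0 = assms
  fix H :: "real^'n^'p" and R :: "real^'p^'p" and y :: "real^'p" and k :: nat
    and M :: "'w measure" and f :: "'w \<Rightarrow> real^'n" and \<epsilon> :: "nat \<Rightarrow> 'w \<Rightarrow> real^'p"
  assume hyps: "sym_pos_def R" "k \<ge> 1" "linear_gaussian_model k m0 K0 R M f \<epsilon>"
  note post = repeated_posterior_iff[OF K0 hyps, of H y]
  note P = sym_pos_def_post_precision[OF K0 hyps(1), of k H]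
  show "\<exists>!\<mu>. repeated_posterior k H y M f \<epsilon> \<mu>" by (simp add: post)
  fix \<mu> assume "repeated_posterior k H y M f \<epsilon> \<mu>"
  then have \<mu>: "\<mu> = gauss_shift (post_mean k m0 K0 R H (\<lambda>i\<in>{1..k}. y)) (post_precision k K0 R H)"
    by (simp add: post)
  show "integrable \<mu> (\<lambda>x. (norm x)\<^sup>2)"
    unfolding \<mu> by (rule integrable_norm_square_gauss_shift[OF P])
  show "invertible (matrix_inv K0 + real k *\<^sub>R (transpose H ** matrix_inv R ** H))"
    using sym_pos_def_invertible[OF P] by (simp add: post_precision_def)
  show "covariance_matrix \<mu> = matrix_inv (matrix_inv K0 + real k *\<^sub>R (transpose H ** matrix_inv R ** H))"
    unfolding \<mu> covariance_matrix_gauss_shift[OF P] by (simp add: post_precision_def)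
  show "mean_vector \<mu> = covariance_matrix \<mu> *v
      (matrix_inv K0 *v m0 + real k *\<^sub>R ((transpose H ** matrix_inv R) *v y))"
    unfolding \<mu> covariance_matrix_gauss_shift[OF P] mean_vector_gauss_shift[OF P] by (rule post_mean_const)
next
  note K0 = assms
  fix R :: "real^'n^'n" and y :: "real^'n" and M :: "nat \<Rightarrow> 'w measure" and f :: "nat \<Rightarrow> 'w \<Rightarrow> real^'n"
    and \<epsilon> :: "nat \<Rightarrow> nat \<Rightarrow> 'w \<Rightarrow> real^'n" and \<mu> :: "nat \<Rightarrow> (real^'n) measure"
  assume R: "sym_pos_def R"
    and model: "\<forall>k\<ge>1. linear_gaussian_model k m0 K0 R (M k) (f k) (\<epsilon> k) \<and>
      repeated_posterior k (mat 1) y (M k) (f k) (\<epsilon> k) (\<mu> k)"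
  have \<mu>: "\<mu> k = gauss_shift (post_mean k m0 K0 R (mat 1) (\<lambda>i\<in>{1..k}. y)) (post_precision k K0 R (mat 1))"
    if "k \<ge> 1" for k
    using model that repeated_posterior_iff[OF K0 R that] by blast
  note P = sym_pos_def_post_precision[OF K0 R, of _ "mat 1"]
  have cov: "covariance_matrix (\<mu> k) = matrix_inv (post_precision k K0 R (mat 1))" if "k \<ge> 1" for k
    using that by (simp add: \<mu> covariance_matrix_gauss_shift[OF P])
  then show "covariance_matrix (\<mu> k) = matrix_inv (matrix_inv K0 + real k *\<^sub>R matrix_inv R)" if "k \<ge> 1" for k
    using that by (simp add: post_precision_mat_1)
  \<comment> \<open>Nothing is known about \<open>\<mu> 0\<close>, so the explicit sequences agree
    with the given ones only from \<open>k = 1\<close> on.\<close>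
  show "(\<lambda>k. covariance_matrix (\<mu> k)) \<longlonglongrightarrow> 0"
  proof (rule Lim_transform_eventually[OF post_covariance_tendsto_0[OF K0 R]])
    show "\<forall>\<^sub>F k in sequentially. matrix_inv (post_precision k K0 R (mat 1)) = covariance_matrix (\<mu> k)"
      using eventually_ge_at_top[of "1::nat"] by eventually_elim (simp add: cov)
  qed
  show "(\<lambda>k. mean_vector (\<mu> k)) \<longlonglongrightarrow> y"
  proof (rule Lim_transform_eventually[OF post_mean_tendsto[OF K0 R, of m0]])
    show "\<forall>\<^sub>F k in sequentially. post_mean k m0 K0 R (mat 1) (\<lambda>i\<in>{1..k}. y) = mean_vector (\<mu> k)"
      using eventually_ge_at_top[of "1::nat"] by eventually_elim (simp add: \<mu> mean_vector_gauss_shift[OF P])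
  qed
qed

end
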